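(* Let $k$ be a field of characteristic $2$ and let $R$ be the localization at the ideal $(x_1,\ldots,x_5)$ of the ring $$\frac{k[x_1,\ldots,x_5]}{(x_1^5+x_2^5+x_3^5+x_4^5+x_5^5)}.$$ Let $\tau$ be the test ideal of $R$. Then $\tau$ is not integrally closed: the integral closure of $\tau$ is $(x_1,\ldots,x_5)^3\neq\tau$, and for example $x_1x_2x_3\in(x_1,\ldots,x_5)^3\setminus\tau$.
   Context: Let $R$ be a commutative Noetherian ring of prime characteristic $p>0$; the letter $q$ always denotes a power $p^e$, $e\in\mathbb{N}$. For an ideal $I\subseteq R$, $I^{[q]}$ is the ideal generated by the $q$th powers of all elements of $I$. An element $u\in R$ is in the tight closure $I^*$ of $I$ if there exists $c\in R$, not in any minimal prime of $R$, such that $cu^q\in I^{[q]}$ for all large $q=p^e$. The test ideal $\tau$ of $R$ is the ideal of all $c\in R$ such that for every ideal $I\subseteq R$ and every $u\in I^*$ one has $cu^q\in I^{[q]}$ for all $q=p^e$. *)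

theory Defs
  imports
    "HOL-Algebra.Algebra"
    "HOL-Algebra.Algebraic_Closure_Type"
    "HOL-Library.Poly_Mapping"
    "HOL-Library.Numeral_Type"
begin

section \<open>Localization of a commutative ring\<close>

definition loc_rel :: "('a, 'm) ring_scheme \<Rightarrow> 'a set \<Rightarrow> (('a \<times> 'a) \<times> ('a \<times> 'a)) set" where
  "loc_rel A S = {((a, s), (b, t)).
     a \<in> carrier A \<and> s \<in> S \<and> b \<in> carrier A \<and> t \<in> S \<and>
     (\<exists>u\<in>S. u \<otimes>\<^bsub>A\<^esub> (a \<otimes>\<^bsub>A\<^esub> t \<ominus>\<^bsub>A\<^esub> b \<otimes>\<^bsub>A\<^esub> s) = \<zero>\<^bsub>A\<^esub>)}"

definition loc_frac :: "('a, 'm) ring_scheme \<Rightarrow> 'a set \<Rightarrow> 'a \<Rightarrow> 'a \<Rightarrow> ('a \<times> 'a) set" where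
  "loc_frac A S a s = loc_rel A S `` {(a, s)}"

text \<open>The operations are those of fractions, computed on all representatives of the two classes;
  for a multiplicative subset \<open>S\<close> they respect the equivalence, so the unions below are unions of
  one and the same class.\<close>

definition localization :: "('a, 'm) ring_scheme \<Rightarrow> 'a set \<Rightarrow> ('a \<times> 'a) set ring" where
  "localization A S =
    \<lparr> carrier = (carrier A \<times> S) // loc_rel A S,
      monoid.mult = (\<lambda>U V. \<Union>(a, s)\<in>U. \<Union>(b, t)\<in>V. loc_frac A S (a \<otimes>\<^bsub>A\<^esub> b) (s \<otimes>\<^bsub>A\<^esub> t)),
      one = loc_frac A S \<one>\<^bsub>A\<^esub> \<one>\<^bsub>A\<^esub>,
      ring.zero = loc_frac A S \<zero>\<^bsub>A\<^esub> \<one>\<^bsub>A\<^esub>,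
      ring.add = (\<lambda>U V. \<Union>(a, s)\<in>U. \<Union>(b, t)\<in>V.
        loc_frac A S (a \<otimes>\<^bsub>A\<^esub> t \<oplus>\<^bsub>A\<^esub> b \<otimes>\<^bsub>A\<^esub> s) (s \<otimes>\<^bsub>A\<^esub> t)) \<rparr>"

definition localization_at :: "('a, 'm) ring_scheme \<Rightarrow> 'a set \<Rightarrow> ('a \<times> 'a) set ring" where
  "localization_at A P = localization A (carrier A - P)"


section \<open>Tight closure and the test ideal\<close>

text \<open>Throughout, \<open>p\<close> is the characteristic of the ring.\<close>

definition minimal_prime :: "('a, 'm) ring_scheme \<Rightarrow> 'a set \<Rightarrow> bool" where
  "minimal_prime R P \<longleftrightarrow>
     primeideal P R \<and> (\<forall>Q. primeideal Q R \<and> Q \<subseteq> P \<longrightarrow> Q = P)"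

definition frobenius_power :: "('a, 'm) ring_scheme \<Rightarrow> 'a set \<Rightarrow> nat \<Rightarrow> 'a set" where
  "frobenius_power R I q = genideal R {a [^]\<^bsub>R\<^esub> q | a. a \<in> I}"

definition tight_closure :: "('a, 'm) ring_scheme \<Rightarrow> nat \<Rightarrow> 'a set \<Rightarrow> 'a set" where
  "tight_closure R p I = {u \<in> carrier R.
     \<exists>c\<in>carrier R. (\<forall>P. minimal_prime R P \<longrightarrow> c \<notin> P) \<and>
       (\<exists>e0. \<forall>e\<ge>e0. c \<otimes>\<^bsub>R\<^esub> u [^]\<^bsub>R\<^esub> (p ^ e) \<in> frobenius_power R I (p ^ e))}"

definition test_ideal :: "('a, 'm) ring_scheme \<Rightarrow> nat \<Rightarrow> 'a set" where
  "test_ideal R p = {c \<in> carrier R.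
     \<forall>I. ideal I R \<longrightarrow> (\<forall>u\<in>tight_closure R p I.
       \<forall>e. c \<otimes>\<^bsub>R\<^esub> u [^]\<^bsub>R\<^esub> (p ^ e) \<in> frobenius_power R I (p ^ e))}"


section \<open>Integral closure of ideals\<close>

primrec ideal_power :: "('a, 'm) ring_scheme \<Rightarrow> 'a set \<Rightarrow> nat \<Rightarrow> 'a set" where
  "ideal_power R I 0 = carrier R"
| "ideal_power R I (Suc n) = ideal_prod R I (ideal_power R I n)"

definition integral_closure :: "('a, 'm) ring_scheme \<Rightarrow> 'a set \<Rightarrow> 'a set" where
  "integral_closure R I = {r \<in> carrier R.
     \<exists>n\<ge>1. \<exists>a :: nat \<Rightarrow> 'a. (\<forall>i\<in>{1..n}. a i \<in> ideal_power R I i) \<and>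
       r [^]\<^bsub>R\<^esub> n \<oplus>\<^bsub>R\<^esub> (\<Oplus>\<^bsub>R\<^esub>i\<in>{1..n}. a i \<otimes>\<^bsub>R\<^esub> r [^]\<^bsub>R\<^esub> (n - i)) = \<zero>\<^bsub>R\<^esub>}"

definition integrally_closed_ideal :: "('a, 'm) ring_scheme \<Rightarrow> 'a set \<Rightarrow> bool" where
  "integrally_closed_ideal R I \<longleftrightarrow> integral_closure R I = I"


section \<open>The local ring of the Fermat quintic\<close>

text \<open>Polynomials in the variables \<open>poly_var 1, \<dots>, poly_var 5\<close>, indexed by the type \<open>5\<close> of integers modulo
  \<open>5\<close>, on which the numerals \<open>1, \<dots>, 5\<close> are the five distinct elements (with \<open>5 = 0\<close>).\<close>

type_synonym 'k poly5 = "(5 \<Rightarrow>\<^sub>0 nat) \<Rightarrow>\<^sub>0 'k"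

definition poly_var :: "5 \<Rightarrow> 'k::field poly5" where
  "poly_var i = Poly_Mapping.single (Poly_Mapping.single i 1) 1"

definition fermat_quintic :: "'k::field poly5" where
  "fermat_quintic = (\<Sum>i\<in>UNIV. poly_var i ^ 5)"

abbreviation poly5_ring :: "'k::field poly5 ring" where
  "poly5_ring \<equiv> ring_of_type_algebra"

definition fermat_ideal :: "'k::field poly5 set" where
  "fermat_ideal = genideal poly5_ring {fermat_quintic}"

definition fermat_quotient :: "'k::field poly5 set ring" where
  "fermat_quotient = poly5_ring Quot fermat_ideal"

definition quotient_var :: "5 \<Rightarrow> 'k::field poly5 set" where
  "quotient_var i = fermat_ideal +>\<^bsub>poly5_ring\<^esub> poly_var i"

definition quotient_max :: "'k::field poly5 set set" where
  "quotient_max = genideal fermat_quotient (range quotient_var)"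

type_synonym 'k fermat_elem = "('k poly5 set \<times> 'k poly5 set) set"

definition fermat_local_ring :: "'k::field fermat_elem ring" where
  "fermat_local_ring = localization_at fermat_quotient quotient_max"

definition local_var :: "5 \<Rightarrow> 'k::field fermat_elem" where
  "local_var i =
     loc_frac fermat_quotient (carrier fermat_quotient - quotient_max)
       (quotient_var i) \<one>\<^bsub>fermat_quotient\<^esub>"

end

(* Let f be the quintic. A 2^(-e)-linear map phi on polynomials that preserves (f) sends the ideal
   generated by q-th powers of I, q = 2^e, into I. So c u^q in I^[q] implies phi(c) u in I.
   Since f is prime and R is finite over k[all variables except z], any multiplier c may be taken
   free of z, and then some phi of the form "coefficients of f^(q-1) times -" maps c to z^4. Hence
   every x_i^4 lies in the test ideal, and further maps with e = 1 give
     x_j^4 -> x_j^2 x_k^2 -> x_i^2 x_j x_k -> x_i x_l^2  (j, k, l distinct).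
   Conversely, let I = (x_1^5, ..., x_5^5), which contains f. The monomials (x_1 ... x_5)^3 and
   x_i^2 prod_{j /= i} x_j^4 lie in the Frobenius closure of I, and the elements that multiply all of
   them into I lie in (x_i x_j^2) + I. So the test ideal is (x_i x_j^2), which misses x_1 x_2 x_3.
   The square of any element of m^3 lies in the square of (x_i x_j^2) because the Frobenius is
   additive, and m^3 is integrally closed because the associated graded ring k[x]/(f) is a domain. *)

theory Submission
  imports Defs
begin

section \<open>Weighted components of polynomials\<close>

text \<open>The element z^4 is the derivative of f by z, since 5 = 1 in k. It appears because 5(q-1)
  = 4q + (q-5): the top power z^(5(q-1)) in f^(q-1) has quotient 4 modulo q. A multiplier that
  contains z would mix other powers z^(5j) into the same coefficient, hence the elimination of z. As
  k need not be perfect, coefficients are mapped by a functional that is linear over q-th powers, in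
  place of taking roots. The monomials multiplied into I come from duality in k[x]/I: the maximal
  exponents outside (x_i x_j^2), where i = j is allowed, are (1,1,1,1,1) and twice a unit vector;
  subtracting them from (4,4,4,4,4) gives the two families. Primality of f enters three times: it
  makes R a domain in which fractions are compared by cross-multiplication, it drives the
  elimination of z, and it controls powers of initial forms. Every ideal of R is handled through its
  contraction to the polynomials.\<close>

abbreviation (input) lookup where "lookup \<equiv> Poly_Mapping.lookup"
abbreviation (input) keys where "keys \<equiv> Poly_Mapping.keys"
abbreviation (input) single where "single \<equiv> Poly_Mapping.single"

text \<open>The condition \<open>m \<notin> keys p\<close> rules out cancellation between the new
  term and the rest; \<open>quotient_max_eq\<close> relies on it to pass a vanishing constant term
  on to \<open>p\<close>.\<close>

lemma poly_mapping_single_induct [case_names zero add]: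
  assumes "P 0"
    and "\<And>m c p. c \<noteq> 0 \<Longrightarrow> m \<notin> keys p \<Longrightarrow> P p \<Longrightarrow> P (single m c + p)"
  shows "P p"
proof (induction p rule: Poly_Mapping.update_induct)
  case const
  then show ?case by (rule assms(1))
next
  case (update f a b)
  have "Poly_Mapping.update a b f = single a b + f"
    using update.hyps(1)
    by (intro poly_mapping_eqI)
      (auto simp: lookup_update lookup_add lookup_single in_keys_iff)
  then show ?case
    using assms(2) update by metis
qed

text \<open>The weight is left arbitrary because three are used: the total degree, the exponent of a
  single variable, and \<open>sheared_weight\<close>.\<close>

definition wcomp :: "('m \<Rightarrow> nat) \<Rightarrow> nat \<Rightarrow> ('m \<Rightarrow>\<^sub>0 'b::zero) \<Rightarrow> ('m \<Rightarrow>\<^sub>0 'b)" where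
  "wcomp w k p = Poly_Mapping.mapp (\<lambda>m c. c when w m = k) p"

lemma lookup_wcomp: "lookup (wcomp w k p) m = (if w m = k then lookup p m else 0)"
  by (auto simp: wcomp_def lookup_mapp in_keys_iff when_def)

lemma keys_wcomp: "keys (wcomp w k p) = {m \<in> keys p. w m = k}"
  by (auto simp: in_keys_iff lookup_wcomp split: if_splits)

lemma wcomp_add: "wcomp w k (p + q) = wcomp w k p + wcomp w k (q :: 'm \<Rightarrow>\<^sub>0 'b::monoid_add)"
  by (intro poly_mapping_eqI) (simp add: lookup_add lookup_wcomp)

lemma wcomp_0 [simp]: "wcomp w k 0 = 0"
  by (intro poly_mapping_eqI) (simp add: lookup_wcomp)

lemma wcomp_single: "wcomp w k (single m c) = (if w m = k then single m c else 0)"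
  by (intro poly_mapping_eqI) (auto simp: lookup_single lookup_wcomp when_def)

lemma wcomp_eq_0: "(\<And>m. m \<in> keys p \<Longrightarrow> w m \<noteq> k) \<Longrightarrow> wcomp w k p = 0"
  by (intro poly_mapping_eqI) (auto simp: lookup_wcomp in_keys_iff)

lemma wcomp_id: "(\<And>m. m \<in> keys p \<Longrightarrow> w m = k) \<Longrightarrow> wcomp w k p = p"
  by (intro poly_mapping_eqI) (auto simp: lookup_wcomp in_keys_iff)

lemma wcomp_neq_0: "m \<in> keys p \<Longrightarrow> wcomp w (w m) p \<noteq> 0"
  by (metis (mono_tags, lifting) emptyE keys_wcomp keys_zero mem_Collect_eq)

lemma wcomp_mult:
  fixes a b :: "('m::comm_monoid_add) \<Rightarrow>\<^sub>0 ('b::comm_semiring_1)"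
  assumes w: "\<And>m n. w (m + n) = w m + (w n :: nat)"
  shows "wcomp w k (a * b) = (\<Sum>i\<le>k. wcomp w i a * wcomp w (k - i) b)"
proof (induction a rule: poly_mapping_single_induct)
  case zero
  show ?case by simp
next
  case (add m c a)
  have "wcomp w k (single m c * b) = (\<Sum>i\<le>k. wcomp w i (single m c) * wcomp w (k - i) b)"
  proof (induction b rule: poly_mapping_single_induct)
    case zero
    show ?case by simp
  next
    case (add n d b)
    have "(\<Sum>i\<le>k. wcomp w i (single m c) * wcomp w (k - i) (single n d))
        = (\<Sum>i\<le>k. if i = w m then (if w n = k - i then single (m + n) (c * d) else 0) else 0)"
      by (rule sum.cong) (auto simp: wcomp_single mult_single)
    also have "\<dots> = (if w m + w n = k then single (m + n) (c * d) else 0)"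
      by (auto simp: sum.delta')
    also have "\<dots> = wcomp w k (single m c * single n d)"
      by (simp add: mult_single wcomp_single w)
    finally show ?case using add
      by (simp add: wcomp_add distrib_left sum.distrib)
  qed
  then show ?case using add
    by (simp add: wcomp_add distrib_right sum.distrib)
qed

text \<open>In every other term of the convolution one factor lies below its minimal weight and
  vanishes. Since polynomials have no zero divisors, initial forms multiply to a nonzero initial
  form.\<close>

lemma wcomp_mult_low:
  fixes a b :: "('m::comm_monoid_add) \<Rightarrow>\<^sub>0 ('b::comm_semiring_1)"
  assumes w: "\<And>m n. w (m + n) = w m + (w n :: nat)"
    and a: "\<And>m. m \<in> keys a \<Longrightarrow> i \<le> w m" and b: "\<And>m. m \<in> keys b \<Longrightarrow> j \<le> w m"
  shows "wcomp w (i + j) (a * b) = wcomp w i a * wcomp w j b"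
proof -
  have "wcomp w t a * wcomp w (i + j - t) b = 0" if "t \<le> i + j" "t \<noteq> i" for t
  proof (cases "t < i")
    case True
    then have "wcomp w t a = 0" using a by (intro wcomp_eq_0) fastforce
    then show ?thesis by simp
  next
    case False
    then have "wcomp w (i + j - t) b = 0" using b that by (intro wcomp_eq_0) fastforce
    then show ?thesis by simp
  qed
  then have "(\<Sum>t\<le>i+j. wcomp w t a * wcomp w (i + j - t) b)
      = (\<Sum>t\<in>{i}. wcomp w t a * wcomp w (i + j - t) b)"
    by (intro sum.mono_neutral_right) auto
  then show ?thesis by (simp add: wcomp_mult[OF w])
qed

lemma wcomp_mult_high:
  fixes a b :: "('m::comm_monoid_add) \<Rightarrow>\<^sub>0 ('b::comm_semiring_1)"
  assumes w: "\<And>m n. w (m + n) = w m + (w n :: nat)"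
    and a: "\<And>m. m \<in> keys a \<Longrightarrow> w m \<le> i" and b: "\<And>m. m \<in> keys b \<Longrightarrow> w m \<le> j"
  shows "wcomp w (i + j) (a * b) = wcomp w i a * wcomp w j b"
proof -
  have "wcomp w t a * wcomp w (i + j - t) b = 0" if "t \<le> i + j" "t \<noteq> i" for t
  proof (cases "t > i")
    case True
    then have "wcomp w t a = 0" using a by (intro wcomp_eq_0) fastforce
    then show ?thesis by simp
  next
    case False
    then have "wcomp w (i + j - t) b = 0" using b that by (intro wcomp_eq_0) fastforce
    then show ?thesis by simp
  qed
  then have "(\<Sum>t\<le>i+j. wcomp w t a * wcomp w (i + j - t) b)
      = (\<Sum>t\<in>{i}. wcomp w t a * wcomp w (i + j - t) b)"
    by (intro sum.mono_neutral_right) auto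
  then show ?thesis by (simp add: wcomp_mult[OF w])
qed

lemma wcomp_mult_homogeneous:
  fixes a b :: "('m::comm_monoid_add) \<Rightarrow>\<^sub>0 ('b::comm_semiring_1)"
  assumes w: "\<And>m n. w (m + n) = w m + (w n :: nat)"
    and a: "\<And>m. m \<in> keys a \<Longrightarrow> w m = i"
  shows "wcomp w k (a * b) = (if i \<le> k then a * wcomp w (k - i) b else 0)"
proof -
  have "wcomp w t a = (if t = i then a else 0)" for t
    using a by (auto simp: wcomp_id intro!: wcomp_eq_0)
  then have "wcomp w k (a * b) = (\<Sum>t\<le>k. if t = i then a * wcomp w (k - t) b else 0)"
    by (subst wcomp_mult[OF w], intro sum.cong) auto
  then show ?thesis by (simp add: sum.delta')
qed

lemma keys_multE:
  fixes a b :: "('m::monoid_add) \<Rightarrow>\<^sub>0 ('b::semiring_0)"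
  assumes "m \<in> keys (a * b)"
  obtains m1 m2 where "m1 \<in> keys a" "m2 \<in> keys b" "m = m1 + m2"
  using keys_mult[of a b] assms by blast

lemma keys_addE:
  assumes "m \<in> keys (a + b)"
  obtains "m \<in> keys a" | "m \<in> keys b"
  using keys_add[of a b] assms by blast

lemma keys_sumE:
  assumes "m \<in> keys (\<Sum>i\<in>A. g i)"
  obtains i where "i \<in> A" "m \<in> keys (g i)"
proof -
  have "\<exists>i\<in>A. m \<in> keys (g i)"
  proof (rule ccontr)
    assume "\<not> ?thesis"
    then have "lookup (\<Sum>i\<in>A. g i) m = 0"
      by (auto simp: lookup_sum in_keys_iff intro!: sum.neutral)
    with assms show False by (simp add: in_keys_iff)
  qed
  then show ?thesis using that by blast
qed

lemma poly_mapping_sum_singles: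
  "p = (\<Sum>m\<in>keys p. single m (lookup p m))"
proof (rule poly_mapping_eqI)
  fix n
  have "lookup (\<Sum>m\<in>keys p. single m (lookup p m)) n = (\<Sum>m\<in>keys p. if m = n then lookup p m else 0)"
    unfolding lookup_sum by (rule sum.cong) (auto simp: lookup_single when_def)
  then show "lookup p n = lookup (\<Sum>m\<in>keys p. single m (lookup p m)) n"
    by (simp add: sum.delta' in_keys_iff)
qed


section \<open>Frobenius in characteristic two\<close>

lemma char2_uminus: "(2::'a::comm_ring_1) = 0 \<Longrightarrow> - a = (a::'a)"
  by (metis add_eq_0_iff2 mult_2 mult_zero_left)

lemma char2_minus: "(2::'a::comm_ring_1) = 0 \<Longrightarrow> a - b = a + (b::'a)"
  by (metis char2_uminus diff_conv_add_uminus)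

lemma char2_power_add:
  assumes "(2::'a::comm_ring_1) = 0"
  shows "(a + b :: 'a) ^ (2 ^ e) = a ^ (2 ^ e) + b ^ (2 ^ e)"
proof (induction e)
  case (Suc e)
  have "(a + b) ^ (2 ^ Suc e) = (a ^ (2 ^ e) + b ^ (2 ^ e))\<^sup>2"
    using Suc by (simp add: power_mult power2_eq_square mult_2 power_add)
  also have "\<dots> = (a ^ (2 ^ e))\<^sup>2 + (b ^ (2 ^ e))\<^sup>2 + 2 * a ^ (2 ^ e) * b ^ (2 ^ e)"
    by (rule power2_sum)
  also have "\<dots> = a ^ (2 ^ Suc e) + b ^ (2 ^ Suc e)"
    using assms by (simp flip: power_mult add: mult.commute)
  finally show ?case .
qed simp

lemma char2_power_sum:
  assumes "(2::'a::comm_ring_1) = 0"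
  shows "(\<Sum>i\<in>A. g i :: 'a) ^ (2 ^ e) = (\<Sum>i\<in>A. g i ^ (2 ^ e))"
  by (induction A rule: infinite_finite_induct) (auto simp: char2_power_add[OF assms] power_0_left)

text \<open>Let k act on itself through 2^e-th powers. This is a vector space, possibly of infinite
  dimension when k is imperfect, and a basis extending {\<open>\<beta>\<close>} supplies the
  functional.\<close>

lemma exists_frobenius_functional:
  fixes \<beta> :: "'k::field"
  assumes char2: "(2::'k) = 0" and "\<beta> \<noteq> 0"
  obtains \<mu> :: "'k \<Rightarrow> 'k" where "\<And>a b. \<mu> (a + b) = \<mu> a + \<mu> b"
    "\<And>a b. \<mu> (a ^ (2 ^ e) * b) = a * \<mu> b" "\<mu> \<beta> = 1"
proof -
  interpret vector_space_pair "\<lambda>a b::'k. a ^ (2 ^ e) * b" "\<lambda>a b::'k. a * b"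
    by unfold_locales (auto simp: algebra_simps char2_power_add[OF char2] power_mult_distrib)
  have "vs1.independent {\<beta>}"
    using assms(2) by simp
  then obtain g where g: "Vector_Spaces.linear (\<lambda>a b. a ^ (2 ^ e) * b) (*) g" "g \<beta> = 1"
    using linear_independent_extend[of "{\<beta>}" "\<lambda>_. 1"] by auto
  show ?thesis
    by (rule that[of g]) (use g in \<open>auto simp: Vector_Spaces.linear_iff\<close>)
qed


section \<open>The Fermat quintic is prime\<close>

lemma UNIV_5: "(UNIV :: 5 set) = {1, 2, 3, 4, 5}"
  by (rule sym, rule card_subset_eq) (simp_all add: card_insert_if)

lemma sum_5: "(\<Sum>i\<in>(UNIV::5 set). g i) = g 1 + g 2 + g 3 + g 4 + (g 5 :: 'a::comm_monoid_add)"
  unfolding UNIV_5 by (simp add: add.assoc)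

lemma poly_var_power: "poly_var i ^ n = single (single i n) (1::'k::field)"
  by (induction n) (auto simp: poly_var_def mult_single simp flip: single_add)

lemma fermat_quintic_eq:
  "(fermat_quintic :: 'k::field poly5) = (\<Sum>i\<in>UNIV. single (single i 5) 1)"
  by (simp add: fermat_quintic_def poly_var_power)

lemma char2_field: "CHAR('k::field) = 2 \<Longrightarrow> (2 :: 'k) = 0"
  by (metis of_nat_CHAR of_nat_numeral)

lemma char2_poly5: "CHAR('k::field) = 2 \<Longrightarrow> (2 :: 'k poly5) = 0"
  using char2_field[where ?'k = 'k] by (metis single_numeral single_zero)

section \<open>Division with respect to one variable\<close>

definition free_of :: "5 \<Rightarrow> 'k::field poly5 \<Rightarrow> bool" where
  "free_of z p \<longleftrightarrow> (\<forall>m\<in>keys p. lookup m z = 0)"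

lemma free_of_1 [simp]: "free_of z 1"
  by (simp add: free_of_def)

lemma free_of_mult: "free_of z p \<Longrightarrow> free_of z q \<Longrightarrow> free_of z (p * q)"
  by (auto simp: free_of_def lookup_add elim!: keys_multE)

lemma free_of_power: "free_of z p \<Longrightarrow> free_of z (p ^ n)"
  by (induction n) (auto intro: free_of_mult)

lemma free_of_sum: "(\<And>i. i \<in> A \<Longrightarrow> free_of z (g i)) \<Longrightarrow> free_of z (\<Sum>i\<in>A. g i)"
  by (auto simp: free_of_def elim!: keys_sumE)

text \<open>Here \<open>n\<close> is only a bound: when no exponent of z attains it,
  \<open>P\<close> is 0. Later arguments can therefore lower a bound without knowing the exact
  degree.\<close>

lemma split_off_top_power:
  fixes p :: "'k::field poly5"
  assumes "\<And>m. m \<in> keys p \<Longrightarrow> lookup m z \<le> n"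
  obtains P p' where "free_of z P" "p = P * poly_var z ^ n + p'"
    "\<And>m. m \<in> keys p' \<Longrightarrow> lookup m z < n"
proof -
  define A where "A = {m \<in> keys p. lookup m z = n}"
  define P where "P = (\<Sum>m\<in>A. single (m - single z n) (lookup p m))"
  define p' where "p' = (\<Sum>m\<in>keys p - A. single m (lookup p m))"
  have "m - single z n + single z n = m" if "m \<in> A" for m
    by (rule poly_mapping_eqI)
      (use that in \<open>auto simp: lookup_add lookup_minus lookup_single A_def when_def\<close>)
  then have "P * poly_var z ^ n = (\<Sum>m\<in>A. single m (lookup p m))"
    by (simp add: P_def poly_var_power sum_distrib_right mult_single)
  moreover have "p = (\<Sum>m\<in>A. single m (lookup p m)) + p'"
    unfolding p'_def by (subst poly_mapping_sum_singles[of p], subst sum.subset_diff[of A])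
      (auto simp: A_def)
  ultimately have "p = P * poly_var z ^ n + p'" by simp
  moreover have "free_of z P"
    unfolding P_def by (rule free_of_sum) (auto simp: free_of_def A_def lookup_minus)
  moreover have "lookup m z < n" if "m \<in> keys p'" for m
    using that assms unfolding p'_def A_def
    by (auto elim!: keys_sumE split: if_splits intro: le_neq_implies_less)
  ultimately show ?thesis using that by blast
qed

text \<open>The leading coefficient \<open>L\<close> is not invertible, so each reduction step costs
  one factor \<open>L\<close>. For \<open>L = 1\<close> this is ordinary division, as used for the
  quintic, which is monic in z.\<close>

lemma pseudo_division:
  fixes p a a' L :: "'k::field poly5"
  assumes L: "free_of z L" and d: "d > 0"
    and a: "a = L * poly_var z ^ d + a'" "\<And>m. m \<in> keys a' \<Longrightarrow> lookup m z < d"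
  obtains N q r where "L ^ N * p = q * a + r" "\<And>m. m \<in> keys r \<Longrightarrow> lookup m z < d"
proof -
  have "\<exists>N q r. L ^ N * p = q * a + r \<and> (\<forall>m\<in>keys r. lookup m z < d)"
    if "\<And>m. m \<in> keys p \<Longrightarrow> lookup m z \<le> n" for n
    using that
  proof (induction n arbitrary: p rule: less_induct)
    case (less n)
    show ?case
    proof (cases "n < d")
      case True
      with less.prems show ?thesis
        by (intro exI[of _ 0] exI[of _ "0 :: 'k poly5"] exI[of _ p]) fastforce
    next
      case False
      obtain P p' where P: "free_of z P" "p = P * poly_var z ^ n + p'"
        "\<And>m. m \<in> keys p' \<Longrightarrow> lookup m z < n"
        using split_off_top_power less.prems by metis
      define p2 where "p2 = L * p' - P * poly_var z ^ (n - d) * a'"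
      have zn: "(poly_var z :: 'k poly5) ^ n = poly_var z ^ (n - d) * poly_var z ^ d"
        using False by (simp flip: power_add)
      have p2: "L * p = P * poly_var z ^ (n - d) * a + p2"
        by (simp add: p2_def P(2) a(1) zn algebra_simps)
      have "lookup m z \<le> n - 1" if "m \<in> keys p2" for m
      proof -
        have "m \<in> keys (L * p') \<or> m \<in> keys (P * poly_var z ^ (n - d) * a')"
          using that by (auto simp: p2_def in_keys_iff lookup_minus)
        moreover have "lookup m z < n" if "m \<in> keys (L * p')"
          using that L P(3) by (force elim!: keys_multE simp: free_of_def lookup_add)
        moreover have "lookup m z < n" if m: "m \<in> keys (P * poly_var z ^ (n - d) * a')"
        proof -
          obtain m1 m2 where m: "m1 \<in> keys (P * poly_var z ^ (n - d))" "m2 \<in> keys a'" "m = m1 + m2"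
            using m by (rule keys_multE)
          from m(1) have "lookup m1 z = n - d" using P(1)
            by (auto elim!: keys_multE simp: free_of_def lookup_add poly_var_power split: if_splits)
          then show ?thesis using a(2)[OF m(2)] m(3) False by (simp add: lookup_add)
        qed
        ultimately show ?thesis by fastforce
      qed
      moreover have "n - 1 < n" using False d by simp
      ultimately obtain N q r where *: "L ^ N * p2 = q * a + r" "\<forall>m\<in>keys r. lookup m z < d"
        using less.IH[of "n - 1" p2] by blast
      have "L ^ Suc N * p = L ^ N * (L * p)" by (simp add: algebra_simps)
      also have "\<dots> = (L ^ N * P * poly_var z ^ (n - d)) * a + L ^ N * p2"
        by (simp only: p2 algebra_simps)
      also have "\<dots> = (L ^ N * P * poly_var z ^ (n - d)) * a + (q * a + r)"
        by (simp only: *(1))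
      also have "\<dots> = (L ^ N * P * poly_var z ^ (n - d) + q) * a + r"
        by (simp add: algebra_simps)
      finally show ?thesis using *(2) by blast
    qed
  qed
  moreover have "\<And>m. m \<in> keys p \<Longrightarrow> lookup m z \<le> Max ((\<lambda>m. lookup m z) ` keys p)"
    by simp
  ultimately show ?thesis using that by meson
qed

lemma obtain_top:
  fixes p :: "'m \<Rightarrow>\<^sub>0 'b::zero" and w :: "'m \<Rightarrow> nat"
  assumes "p \<noteq> 0"
  obtains t where "wcomp w t p \<noteq> 0" "\<And>m. m \<in> keys p \<Longrightarrow> w m \<le> t"
proof -
  have "finite (w ` keys p)" "w ` keys p \<noteq> {}"
    using assms by (auto simp: poly_mapping_eq_iff in_keys_iff fun_eq_iff intro!: poly_mapping_eqI)
  then have "Max (w ` keys p) \<in> w ` keys p" "\<And>m. m \<in> keys p \<Longrightarrow> w m \<le> Max (w ` keys p)"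
    using Max_in by auto
  then show ?thesis using that wcomp_neq_0 by (metis imageE)
qed

lemma obtain_bottom:
  fixes p :: "'m \<Rightarrow>\<^sub>0 'b::zero" and w :: "'m \<Rightarrow> nat"
  assumes "p \<noteq> 0"
  obtains t where "wcomp w t p \<noteq> 0" "\<And>m. m \<in> keys p \<Longrightarrow> t \<le> w m"
proof -
  have "finite (w ` keys p)" "w ` keys p \<noteq> {}"
    using assms by (auto simp: poly_mapping_eq_iff in_keys_iff fun_eq_iff intro!: poly_mapping_eqI)
  then have "Min (w ` keys p) \<in> w ` keys p" "\<And>m. m \<in> keys p \<Longrightarrow> Min (w ` keys p) \<le> w m"
    using Min_in by auto
  then show ?thesis using that wcomp_neq_0 by (metis imageE)
qed

section \<open>Substitution of polynomials for the variables\<close>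

definition subst :: "(5 \<Rightarrow> 'k::field poly5) \<Rightarrow> 'k poly5 \<Rightarrow> 'k poly5" where
  "subst v p = (\<Sum>m\<in>keys p. single 0 (lookup p m) * (\<Prod>i\<in>UNIV. v i ^ lookup m i))"

lemma subst_superset:
  assumes "finite A" "keys p \<subseteq> A"
  shows "subst v p = (\<Sum>m\<in>A. single 0 (lookup p m) * (\<Prod>i\<in>UNIV. v i ^ lookup m i))"
  unfolding subst_def using assms
  by (intro sum.mono_neutral_left) (auto simp: in_keys_iff)

lemma subst_0 [simp]: "subst v 0 = 0"
  by (simp add: subst_def)

lemma subst_add: "subst v (p + q) = subst v p + subst v q"
  by (subst (1 2 3) subst_superset[of "keys p \<union> keys q"])
    (auto simp: keys_add lookup_add single_add distrib_right sum.distrib elim!: keys_addE)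

lemma subst_single: "subst v (single m c) = single 0 c * (\<Prod>i\<in>UNIV. v i ^ lookup m i)"
  by (subst subst_superset[of "{m}"]) auto

lemma subst_mult: "subst v (p * q) = subst v p * subst v q"
proof (induction p rule: poly_mapping_single_induct)
  case (add m c p)
  have "subst v (single m c * q) = subst v (single m c) * subst v q"
  proof (induction q rule: poly_mapping_single_induct)
    case (add n d q)
    have "single 0 (c * d) = (single 0 c * single 0 d :: 'a poly5)"
      by (simp add: mult_single)
    then have "subst v (single m c * single n d) = subst v (single m c) * subst v (single n d)"
      by (simp add: mult_single subst_single lookup_add power_add prod.distrib algebra_simps)
    with add show ?case by (simp add: distrib_left subst_add)
  qed simp
  with add show ?case by (simp add: distrib_right subst_add)
qed simp

lemma subst_1 [simp]: "subst v 1 = 1"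
  using subst_single[of v 0 1] by simp

lemma subst_power: "subst v (p ^ n) = subst v p ^ n"
  by (induction n) (auto simp: subst_mult)

lemma subst_prod: "subst v (\<Prod>i\<in>A. g i) = (\<Prod>i\<in>A. subst v (g i))"
  by (induction A rule: infinite_finite_induct) (auto simp: subst_mult)

lemma subst_sum: "subst v (\<Sum>i\<in>A. g i) = (\<Sum>i\<in>A. subst v (g i))"
  by (induction A rule: infinite_finite_induct) (auto simp: subst_add)

lemma subst_poly_var: "subst v (poly_var i) = v i"
proof -
  have "(\<Prod>j\<in>UNIV. v j ^ lookup (single i 1) j) = (\<Prod>j\<in>UNIV. if j = i then v j else 1)"
    by (rule prod.cong) (auto simp: lookup_single)
  then show ?thesis by (simp add: poly_var_def subst_single)
qed

lemma prod_poly_var: "(\<Prod>i\<in>UNIV. poly_var i ^ lookup m i) = single m (1::'k::field)"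
proof -
  have "(\<Prod>i\<in>A. single (g i) (1::'k)) = single (\<Sum>i\<in>A. g i) 1" for A :: "5 set" and g :: "5 \<Rightarrow> 5 \<Rightarrow>\<^sub>0 nat"
    by (induction A rule: infinite_finite_induct) (auto simp: mult_single)
  moreover have "(\<Sum>i\<in>UNIV. single i (lookup m i)) = m"
    by (rule poly_mapping_eqI) (simp add: lookup_sum lookup_single when_def)
  ultimately show ?thesis by (simp add: poly_var_power)
qed

lemma subst_comp_id:
  assumes "\<And>i. subst v (u i) = poly_var i"
  shows "subst v (subst u p) = p"
proof (induction p rule: poly_mapping_single_induct)
  case (add m c p)
  have "subst v (single 0 c) = single 0 c" for c
    by (simp add: subst_single)
  then have "subst v (subst u (single m c)) = single m c"
    by (simp add: subst_single[of u] subst_mult subst_prod subst_power assms prod_poly_var mult_single)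
  with add show ?case by (simp add: subst_add)
qed simp

lemma wcomp_bottom_mult_neq_0:
  fixes p :: "'k::field poly5"
  assumes "\<And>m n. w (m + n) = w m + (w n :: nat)"
    and "wcomp w i p \<noteq> 0" "\<And>m. m \<in> keys p \<Longrightarrow> i \<le> w m"
    and "wcomp w j q \<noteq> 0" "\<And>m. m \<in> keys q \<Longrightarrow> j \<le> w m"
  shows "wcomp w (i + j) (p * q) \<noteq> 0"
  using assms by (simp add: wcomp_mult_low)

text \<open>The invertible substitution \<open>x\<^sub>1 \<mapsto> x\<^sub>1 + x\<^sub>2\<close> turns the quintic into a polynomial whose initial
  form for the weights \<open>(5, 0, 5, 5, 1)\<close> is the binomial \<open>x\<^sub>5\<^sup>5 + x\<^sub>1 x\<^sub>2\<^sup>4\<close>. Modulo 5, the weight of a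
  monomial is its exponent of \<open>x\<^sub>5\<close>, so the initial form of a polynomial of degree at most 4 in
  \<open>x\<^sub>5\<close> is homogeneous in \<open>x\<^sub>5\<close>, and so is a product of two of them; a nonzero
  multiple of the binomial is not.\<close>

definition shear :: "5 \<Rightarrow> 'k::field poly5" where
  "shear i = (if i = 1 then poly_var 1 + poly_var 2 else poly_var i)"

definition sheared_weight :: "(5 \<Rightarrow>\<^sub>0 nat) \<Rightarrow> nat" where
  "sheared_weight m = 5 * (lookup m 1 + lookup m 3 + lookup m 4) + lookup m 5"

lemma sheared_weight_add: "sheared_weight (m + n) = sheared_weight m + sheared_weight n"
  by (simp add: sheared_weight_def lookup_add)

definition sheared_binomial :: "'k::field poly5" where
  "sheared_binomial = single (single 5 5) 1 + single (single 1 1 + single 2 4) 1"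

lemma subst_shear_fermat_quintic:
  assumes "CHAR('k::field) = 2"
  shows "subst shear (fermat_quintic :: 'k poly5) = sheared_binomial
    + (single (single 1 5) 1 + single (single 1 4 + single 2 1) 1 + single (single 3 5) 1 + single (single 4 5) 1)"
proof -
  have char2: "(2 :: 'k poly5) = 0" using assms by (rule char2_poly5)
  \<comment> \<open>Of the binomial coefficients 1, 5, 10, 10, 5, 1 only the tens are even; the two
    copies of b^5 cancel. All even contributions are collected behind the factor 2.\<close>
  have "(a + b) ^ 5 + b ^ 5 = a ^ 5 + a ^ 4 * b + a * b ^ 4
      + 2 * (2 * a ^ 4 * b + 5 * a ^ 3 * b\<^sup>2 + 5 * a\<^sup>2 * b ^ 3 + 2 * a * b ^ 4 + b ^ 5)" for a b :: "'k poly5"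
    by (simp add: eval_nat_numeral algebra_simps)
  then have *: "(a + b) ^ 5 + b ^ 5 = a ^ 5 + a ^ 4 * b + a * b ^ 4" for a b :: "'k poly5"
    by (simp add: char2)
  have "subst shear (fermat_quintic :: 'k poly5) = ((poly_var 1 + poly_var 2) ^ 5 + poly_var 2 ^ 5)
      + poly_var 3 ^ 5 + poly_var 4 ^ 5 + poly_var 5 ^ 5"
    by (simp add: fermat_quintic_def subst_sum subst_add subst_power subst_poly_var sum_5 shear_def)
  also have "poly_var 1 ^ 4 * poly_var 2 ^ 1 = single (single 1 4 + single 2 1) (1::'k)"
    "poly_var 1 ^ 1 * poly_var 2 ^ 4 = single (single 1 1 + single 2 4) (1::'k)"
    unfolding poly_var_power by (simp_all add: mult_single)
  then have "poly_var 1 ^ 4 * poly_var 2 = single (single 1 4 + single 2 1) (1::'k)"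
    "poly_var 1 * poly_var 2 ^ 4 = single (single 1 1 + single 2 4) (1::'k)"
    by simp_all
  then have "((poly_var 1 + poly_var 2) ^ 5 + poly_var 2 ^ 5)
      + poly_var 3 ^ 5 + poly_var 4 ^ 5 + poly_var 5 ^ 5 = sheared_binomial
    + (single (single 1 5) (1::'k) + single (single 1 4 + single 2 1) 1 + single (single 3 5) 1 + single (single 4 5) 1)"
    unfolding * by (simp add: poly_var_power sheared_binomial_def algebra_simps)
  finally show ?thesis .
qed

lemma wcomp_homogeneous_reduced:
  fixes a :: "'k::field poly5"
  assumes "m \<in> keys (wcomp sheared_weight i a)" "\<And>m. m \<in> keys a \<Longrightarrow> lookup m 5 < 5"
  shows "lookup m 5 = i mod 5"
proof -
  have "m \<in> keys a" "i = 5 * (lookup m 1 + lookup m 3 + lookup m 4) + lookup m 5"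
    using assms(1) by (auto simp: keys_wcomp sheared_weight_def)
  moreover from this(1) have "lookup m 5 < 5" using assms(2) by blast
  ultimately show ?thesis by (metis mod_less mod_mult_self4)
qed

text \<open>The shear is essential: an unsheared binomial such as x_5^5 + x_1^5 is the product of
  x_5 + x_1 and a factor of degree 4, both reduced in x_5. The binomial x_5^5 + x_1 x_2^4 admits no
  such product.\<close>

lemma sheared_reduced_mult_not_dvd:
  fixes a b :: "'k::field poly5"
  assumes char: "CHAR('k) = 2"
    and a: "a \<noteq> 0" "\<And>m. m \<in> keys a \<Longrightarrow> lookup m 5 < 5"
    and b: "b \<noteq> 0" "\<And>m. m \<in> keys b \<Longrightarrow> lookup m 5 < 5"
  shows "\<not> subst shear fermat_quintic dvd a * b"
proof
  let ?w = sheared_weight and ?f = "subst shear fermat_quintic :: 'k poly5"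
  assume "?f dvd a * b"
  then obtain h where h: "a * b = ?f * h" by (elim dvdE)
  have "h \<noteq> 0" using h a(1) b(1) by auto
  obtain i where i: "wcomp ?w i a \<noteq> 0" "\<And>m. m \<in> keys a \<Longrightarrow> i \<le> ?w m"
    using obtain_bottom[OF a(1)] by blast
  obtain j where j: "wcomp ?w j b \<noteq> 0" "\<And>m. m \<in> keys b \<Longrightarrow> j \<le> ?w m"
    using obtain_bottom[OF b(1)] by blast
  obtain l where l: "wcomp ?w l h \<noteq> 0" "\<And>m. m \<in> keys h \<Longrightarrow> l \<le> ?w m"
    using obtain_bottom[OF \<open>h \<noteq> 0\<close>] by blast
  have f5: "wcomp ?w 5 ?f = sheared_binomial"
    by (simp add: subst_shear_fermat_quintic[OF char] sheared_binomial_def wcomp_add wcomp_single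
        sheared_weight_def lookup_add lookup_single)
  have fkeys: "5 \<le> ?w m" if "m \<in> keys ?f" for m
    using that unfolding subst_shear_fermat_quintic[OF char] sheared_binomial_def
    by (auto elim!: keys_addE simp: sheared_weight_def lookup_add lookup_single split: if_splits)
  have binom: "(sheared_binomial :: 'k poly5) \<noteq> 0"
  proof -
    have "single 1 1 + single 2 4 \<noteq> (single 5 5 :: 5 \<Rightarrow>\<^sub>0 nat)"
    proof
      assume "single 1 1 + single 2 4 = (single 5 5 :: 5 \<Rightarrow>\<^sub>0 nat)"
      from arg_cong[OF this, of "\<lambda>m. lookup m 5"] show False
        by (simp add: lookup_add lookup_single)
    qed
    then have "lookup (sheared_binomial :: 'k poly5) (single 5 5) = 1"
      by (auto simp: sheared_binomial_def lookup_add lookup_single when_def)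
    then show ?thesis by auto
  qed
  have A: "wcomp ?w (i + j) (a * b) \<noteq> 0"
    by (rule wcomp_bottom_mult_neq_0) (use i j sheared_weight_add in auto)
  have B: "wcomp ?w (5 + l) (?f * h) \<noteq> 0"
    by (rule wcomp_bottom_mult_neq_0) (use f5 binom fkeys l sheared_weight_add in auto)
  have C: "wcomp ?w t (a * b) = 0" if "t < i + j" for t
  proof (rule wcomp_eq_0)
    fix m assume "m \<in> keys (a * b)"
    then obtain m1 m2 where "m1 \<in> keys a" "m2 \<in> keys b" "m = m1 + m2" by (rule keys_multE)
    then show "?w m \<noteq> t" using i(2)[of m1] j(2)[of m2] that by (simp add: sheared_weight_add)
  qed
  have D: "wcomp ?w t (?f * h) = 0" if "t < 5 + l" for t
  proof (rule wcomp_eq_0)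
    fix m assume "m \<in> keys (?f * h)"
    then obtain m1 m2 where "m1 \<in> keys ?f" "m2 \<in> keys h" "m = m1 + m2" by (rule keys_multE)
    then show "?w m \<noteq> t" using fkeys[of m1] l(2)[of m2] that by (simp add: sheared_weight_add)
  qed
  \<comment> \<open>Both sides are the same polynomial, so their lowest weights agree.\<close>
  have ijl: "i + j = 5 + l"
    using A B C[of "5 + l"] D[of "i + j"] unfolding h
    by (cases "i + j" "5 + l" rule: linorder_cases) auto
  have "wcomp ?w (i + j) (a * b) = wcomp ?w i a * wcomp ?w j b"
    by (rule wcomp_mult_low) (use i j sheared_weight_add in auto)
  moreover have "wcomp ?w (5 + l) (?f * h) = wcomp ?w 5 ?f * wcomp ?w l h"
    by (rule wcomp_mult_low) (use fkeys l sheared_weight_add in auto)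
  ultimately have *: "wcomp ?w i a * wcomp ?w j b = sheared_binomial * wcomp ?w l h"
    by (simp only: h ijl f5)
  let ?z = "\<lambda>m. lookup m (5::5)"
  \<comment> \<open>Multiplying by the binomial adds 0 to the lowest exponent of x_5 and 5 to the
    highest. If the product has a single exponent of x_5, then s = 5 + t, against s \<le> t.\<close>
  obtain s where s: "wcomp ?z s (wcomp ?w l h) \<noteq> 0" "\<And>m. m \<in> keys (wcomp ?w l h) \<Longrightarrow> s \<le> ?z m"
    using obtain_bottom[OF l(1)] by blast
  obtain t where t: "wcomp ?z t (wcomp ?w l h) \<noteq> 0" "\<And>m. m \<in> keys (wcomp ?w l h) \<Longrightarrow> ?z m \<le> t"
    using obtain_top[OF l(1)] by blast
  have degz: "?z m = i mod 5 + j mod 5" if "m \<in> keys (sheared_binomial * wcomp ?w l h)" for m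
  proof -
    from that[folded *] obtain m1 m2 where m: "m1 \<in> keys (wcomp ?w i a)" "m2 \<in> keys (wcomp ?w j b)" "m = m1 + m2"
      by (rule keys_multE)
    from m(1) a(2) have "?z m1 = i mod 5" by (rule wcomp_homogeneous_reduced)
    moreover from m(2) b(2) have "?z m2 = j mod 5" by (rule wcomp_homogeneous_reduced)
    ultimately show ?thesis by (simp add: m(3) lookup_add)
  qed
  have degz': "u = i mod 5 + j mod 5" if "wcomp ?z u (sheared_binomial * wcomp ?w l h) \<noteq> 0" for u
    using that wcomp_eq_0[of "sheared_binomial * wcomp ?w l h" ?z u] degz by auto
  have zadd: "?z (m + n) = ?z m + ?z n" for m n
    by (simp add: lookup_add)
  have bkeys: "?z m \<le> 5" if "m \<in> keys (sheared_binomial :: 'k poly5)" for m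
    using that by (auto elim!: keys_addE simp: sheared_binomial_def lookup_add lookup_single split: if_splits)
  have "wcomp ?z 0 sheared_binomial = single (single 1 1 + single 2 4) (1::'k)"
    "wcomp ?z 5 sheared_binomial = single (single 5 5) (1::'k)"
    by (simp_all add: sheared_binomial_def wcomp_add wcomp_single lookup_add lookup_single)
  then have b05: "wcomp ?z 0 sheared_binomial \<noteq> (0 :: 'k poly5)" "wcomp ?z 5 sheared_binomial \<noteq> (0 :: 'k poly5)"
    by (metis lookup_single_eq lookup_zero zero_neq_one)+
  have "wcomp ?z (0 + s) (sheared_binomial * wcomp ?w l h) \<noteq> 0"
    by (rule wcomp_bottom_mult_neq_0) (use b05 s zadd in auto)
  then have "0 + s = i mod 5 + j mod 5" by (rule degz')
  moreover have "wcomp ?z (5 + t) (sheared_binomial * wcomp ?w l h) \<noteq> 0"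
    by (subst wcomp_mult_high) (use b05 t bkeys zadd in auto)
  then have "5 + t = i mod 5 + j mod 5" by (rule degz')
  moreover have "s \<le> t"
    using s(2) t wcomp_eq_0[of "wcomp ?w l h" ?z t] by force
  ultimately show False by simp
qed

lemma reduce_mod_quintic:
  fixes p :: "'k::field poly5"
  assumes "f = poly_var z ^ 5 + g" "\<And>m. m \<in> keys g \<Longrightarrow> lookup m z < 5"
  obtains q r where "p = q * f + r" "\<And>m. m \<in> keys r \<Longrightarrow> lookup m z < 5"
proof -
  obtain N q r where "1 ^ N * p = q * f + r" "\<And>m. m \<in> keys r \<Longrightarrow> lookup m z < 5"
    using pseudo_division[of z 1 5 f g p] assms by auto
  then show ?thesis using that by simp
qed

lemma fermat_quintic_dvd_mult:
  fixes a b :: "'k::field poly5"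
  assumes char: "CHAR('k) = 2" and dvd: "fermat_quintic dvd a * b"
  shows "fermat_quintic dvd a \<or> fermat_quintic dvd b"
proof -
  let ?f = "subst shear fermat_quintic :: 'k poly5"
  \<comment> \<open>Adding x_2 twice is adding zero, so the shear is an involution and divisibility
    by f can be tested after it.\<close>
  have inv: "subst shear (subst shear p) = p" for p :: "'k poly5"
  proof (rule subst_comp_id)
    have "poly_var 2 + poly_var 2 = (0 :: 'k poly5)"
      using char2_poly5[OF char] by (simp flip: mult_2)
    then show "subst shear (shear i) = (poly_var i :: 'k poly5)" for i
      by (auto simp: shear_def subst_add subst_poly_var add.assoc)
  qed
  have dvd_iff: "?f dvd subst shear p \<longleftrightarrow> fermat_quintic dvd p" for p
    by (metis dvd_def inv subst_mult)
  define g :: "'k poly5" where "g = single (single 1 1 + single 2 4) 1 +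
     (single (single 1 5) (1::'k) + single (single 1 4 + single 2 1) 1 + single (single 3 5) 1 + single (single 4 5) 1)"
  have f: "?f = poly_var 5 ^ 5 + g" "\<And>m. m \<in> keys g \<Longrightarrow> lookup m 5 < 5"
    by (auto simp: subst_shear_fermat_quintic[OF char] sheared_binomial_def g_def poly_var_power
        lookup_add lookup_single elim!: keys_addE split: if_splits)
  obtain q1 r1 where 1: "subst shear a = q1 * ?f + r1" "\<And>m. m \<in> keys r1 \<Longrightarrow> lookup m 5 < 5"
    using reduce_mod_quintic[OF f] by blast
  obtain q2 r2 where 2: "subst shear b = q2 * ?f + r2" "\<And>m. m \<in> keys r2 \<Longrightarrow> lookup m 5 < 5"
    using reduce_mod_quintic[OF f] by blast
  have "subst shear (a * b) = (q1 * q2 * ?f + q1 * r2 + q2 * r1) * ?f + r1 * r2"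
    by (simp add: subst_mult 1(1) 2(1) algebra_simps)
  moreover have "?f dvd subst shear (a * b)"
    using dvd dvd_iff by blast
  ultimately have "?f dvd r1 * r2"
    by (simp add: dvd_add_right_iff)
  then have "r1 = 0 \<or> r2 = 0"
    using sheared_reduced_mult_not_dvd[OF char _ 1(2) _ 2(2)] by blast
  then show ?thesis
    using 1(1) 2(1) dvd_iff by (metis add.right_neutral dvd_triv_right)
qed

lemma fermat_quintic_split:
  obtains g where "(fermat_quintic :: 'k::field poly5) = poly_var z ^ 5 + g" "free_of z g"
proof -
  have "(fermat_quintic :: 'k poly5) = poly_var z ^ 5 + (\<Sum>i\<in>UNIV - {z}. poly_var i ^ 5)"
    unfolding fermat_quintic_def by (subst sum.remove[of _ z]) auto
  moreover have "free_of z (\<Sum>i\<in>UNIV - {z}. poly_var i ^ 5 :: 'k poly5)"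
    by (rule free_of_sum) (auto simp: free_of_def poly_var_power lookup_single)
  ultimately show ?thesis using that by blast
qed

lemma fermat_quintic_neq_0 [simp]: "(fermat_quintic :: 'k::field poly5) \<noteq> 0"
proof -
  have "lookup (fermat_quintic :: 'k poly5) (single 1 5) = (\<Sum>i\<in>UNIV. if i = (1::5) then 1 else 0)"
    unfolding fermat_quintic_eq lookup_sum
    by (intro sum.cong) (auto simp: lookup_single when_def split: if_splits dest!: arg_cong[of "single _ 5" _ "\<lambda>m. lookup m 1"])
  then show ?thesis by auto
qed

text \<open>Since f is monic of degree 5 in every variable, the top power of z cannot cancel in a
  multiple. This is the test for non-divisibility: a nonzero polynomial with all exponents of z
  below 5 is not a multiple of f.\<close>

lemma fermat_quintic_multiple_degree:
  fixes a :: "'k::field poly5"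
  assumes "fermat_quintic dvd a" "a \<noteq> 0"
  obtains m where "m \<in> keys a" "lookup m z \<ge> 5"
proof -
  obtain h where h: "a = fermat_quintic * h" using assms(1) by (elim dvdE)
  then have "h \<noteq> 0" using assms(2) by auto
  let ?z = "\<lambda>m. lookup m z"
  obtain t where t: "wcomp ?z t h \<noteq> 0" "\<And>m. m \<in> keys h \<Longrightarrow> ?z m \<le> t"
    using obtain_top[OF \<open>h \<noteq> 0\<close>] by blast
  obtain g where g: "(fermat_quintic :: 'k poly5) = poly_var z ^ 5 + g" "free_of z g"
    using fermat_quintic_split by blast
  have "wcomp ?z 5 (fermat_quintic :: 'k poly5) = poly_var z ^ 5"
    using g(2) by (auto simp: g(1) wcomp_add poly_var_power wcomp_single free_of_def intro!: wcomp_eq_0)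
  moreover have "poly_var z ^ 5 \<noteq> (0 :: 'k poly5)"
    unfolding poly_var_power by (metis lookup_single_eq lookup_zero zero_neq_one)
  moreover have "?z m \<le> 5" if "m \<in> keys (fermat_quintic :: 'k poly5)" for m
    using that g(2) unfolding g(1) by (auto elim!: keys_addE simp: poly_var_power free_of_def split: if_splits)
  ultimately have "wcomp ?z (5 + t) a \<noteq> 0"
    unfolding h by (subst wcomp_mult_high) (use t in \<open>auto simp: lookup_add\<close>)
  then obtain m where "m \<in> keys a" "?z m = 5 + t"
    using wcomp_eq_0 by metis
  then show ?thesis using that by simp
qed


text \<open>In place of a norm, take a nonzero element of the ideal (c, f) of least degree d in z.
  If d > 0, pseudo-division of f by it leaves remainder zero by minimality, and the primality of f
  turns this into a contradiction.\<close>

lemma exists_free_of_multiple: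
  fixes c :: "'k::field poly5"
  assumes char: "CHAR('k) = 2" and c: "\<not> fermat_quintic dvd c"
  obtains q h where "q * c + h * fermat_quintic \<noteq> 0" "free_of z (q * c + h * fermat_quintic)"
proof -
  let ?f = "fermat_quintic :: 'k poly5"
  obtain g where g: "?f = poly_var z ^ 5 + g" "free_of z g"
    by (rule fermat_quintic_split)
  define P where "P d \<longleftrightarrow> (\<exists>q h. q * c + h * ?f \<noteq> 0 \<and> (\<forall>m\<in>keys (q * c + h * ?f). lookup m z \<le> d))" for d
  \<comment> \<open>Reduction modulo the monic quintic leaves degree at most 4. The bound is needed
    again below, to see that f does not divide the minimal element.\<close>
  have "P 4"
  proof -
    obtain q r where r: "c = q * ?f + r" "\<And>m. m \<in> keys r \<Longrightarrow> lookup m z < 5"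
      using reduce_mod_quintic[OF g(1)] g(2) unfolding free_of_def by (metis zero_less_numeral)
    then have eq: "1 * c + (- q) * ?f = r" by simp
    have "r \<noteq> 0" using r c by auto
    moreover have "lookup m z \<le> 4" if "m \<in> keys r" for m
      using r(2)[OF that] by simp
    ultimately show ?thesis unfolding P_def
      by (intro exI[of _ 1] exI[of _ "- q"]) (auto simp only: eq)
  qed
  define d where "d = (LEAST d. P d)"
  have "P d" "d \<le> 4"
    unfolding d_def using \<open>P 4\<close> by (auto intro: LeastI Least_le)
  then obtain q h where qh: "q * c + h * ?f \<noteq> 0" "\<And>m. m \<in> keys (q * c + h * ?f) \<Longrightarrow> lookup m z \<le> d"
    unfolding P_def by blast
  let ?a = "q * c + h * ?f"
  have "d = 0"
  proof (rule ccontr)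
    assume "d \<noteq> 0"
    obtain L a' where L: "free_of z L" "?a = L * poly_var z ^ d + a'" "\<And>m. m \<in> keys a' \<Longrightarrow> lookup m z < d"
      using split_off_top_power qh(2) by metis
    obtain N q' r where r: "L ^ N * ?f = q' * ?a + r" "\<And>m. m \<in> keys r \<Longrightarrow> lookup m z < d"
      using pseudo_division[OF L(1) _ L(2,3)] \<open>d \<noteq> 0\<close> by blast
    have eq: "(- q' * q) * c + (L ^ N - q' * h) * ?f = r"
      using r(1) by (simp add: algebra_simps)
    have notP: "\<not> P (d - 1)"
      using \<open>d \<noteq> 0\<close> unfolding d_def by (intro not_less_Least) auto
    have r': "\<forall>m\<in>keys r. lookup m z \<le> d - 1"
      using r(2) by fastforce
    have "r = 0"
    proof (rule ccontr)
      assume "r \<noteq> 0"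
      then have "P (d - 1)" unfolding P_def
        by (intro exI[of _ "- q' * q"] exI[of _ "L ^ N - q' * h"]) (use r' in \<open>simp only: eq, simp\<close>)
      with notP show False ..
    qed
    have "L \<noteq> 0"
    proof
      assume "L = 0"
      then have "\<forall>m\<in>keys ?a. lookup m z \<le> d - 1"
        using L(2,3) by fastforce
      then show False using notP qh(1) unfolding P_def by blast
    qed
    have "q' * ?a = ?f * L ^ N"
      using r(1) \<open>r = 0\<close> by (simp add: mult.commute)
    then have "?f dvd q' * ?a" by (rule dvdI)
    moreover have "\<not> ?f dvd ?a"
    proof
      assume "?f dvd ?a"
      then obtain m where "m \<in> keys ?a" "lookup m z \<ge> 5"
        using qh(1) by (rule fermat_quintic_multiple_degree)
      with qh(2)[of m] \<open>d \<le> 4\<close> show False by simp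
    qed
    \<comment> \<open>Now f cancels and a power of \<open>L\<close>, which is free of z, becomes a
      multiple of an element of positive degree in z.\<close>
    ultimately have "?f dvd q'"
      using fermat_quintic_dvd_mult[OF char] by blast
    then obtain q'' where q'': "q' = ?f * q''" by (elim dvdE)
    have *: "L ^ N = q'' * ?a"
      using r(1) \<open>r = 0\<close> q'' fermat_quintic_neq_0 by (simp add: mult.assoc mult.commute[of _ ?f])
    let ?z = "\<lambda>m. lookup m z"
    have "q'' \<noteq> 0" using * \<open>L \<noteq> 0\<close> by auto
    obtain t where t: "wcomp ?z t q'' \<noteq> 0" "\<And>m. m \<in> keys q'' \<Longrightarrow> ?z m \<le> t"
      using obtain_top[OF \<open>q'' \<noteq> 0\<close>] by blast
    have "wcomp ?z d ?a \<noteq> 0"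
    proof
      assume "wcomp ?z d ?a = 0"
      then have "?z m \<noteq> d" if "m \<in> keys ?a" for m
        using wcomp_neq_0[OF that, of ?z] by auto
      then have "\<forall>m\<in>keys ?a. ?z m \<le> d - 1"
        using qh(2) by fastforce
      then show False using notP qh(1) unfolding P_def by blast
    qed
    then have "wcomp ?z (t + d) (q'' * ?a) \<noteq> 0"
      by (subst wcomp_mult_high) (use t qh(2) in \<open>auto simp: lookup_add\<close>)
    moreover have "wcomp ?z (t + d) (L ^ N) = 0"
      using free_of_power[OF L(1), of N] \<open>d \<noteq> 0\<close> by (intro wcomp_eq_0) (auto simp: free_of_def)
    ultimately show False by (simp add: *)
  qed
  then show ?thesis using qh that by (simp add: free_of_def)
qed


section \<open>Cartier operators\<close>

definition stretch :: "nat \<Rightarrow> (5 \<Rightarrow>\<^sub>0 nat) \<Rightarrow> (5 \<Rightarrow>\<^sub>0 nat)" where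
  "stretch n m = Poly_Mapping.map (\<lambda>k. n * k) m"

lemma lookup_stretch [simp]: "lookup (stretch n m) i = n * lookup m i"
  by (simp add: stretch_def Poly_Mapping.map.rep_eq when_def)

lemma power_single: "single m c ^ n = single (stretch n m) (c ^ n :: 'k::field)"
proof (induction n)
  case 0
  have "stretch 0 m = 0" by (rule poly_mapping_eqI) simp
  then show ?case by simp
next
  case (Suc n)
  have "m + stretch n m = stretch (Suc n) m" by (rule poly_mapping_eqI) (simp add: lookup_add)
  with Suc show ?case by (simp add: mult_single)
qed

text \<open>The subtraction of exponents is truncated, so the guard is what distinguishes true
  divisibility of monomials.\<close>

lemma lookup_single_mult:
  fixes p :: "'k::field poly5"
  shows "lookup (single m c * p) n = (if \<forall>i. lookup m i \<le> lookup n i then c * lookup p (n - m) else 0)"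
proof (induction p rule: poly_mapping_single_induct)
  case (add k d p)
  have "m + k = n \<longleftrightarrow> (\<forall>i. lookup m i \<le> lookup n i) \<and> k = n - m"
  proof
    assume "m + k = n"
    then have "n = m + k" by simp
    then show "(\<forall>i. lookup m i \<le> lookup n i) \<and> k = n - m"
      by (simp add: lookup_add)
  next
    assume "(\<forall>i. lookup m i \<le> lookup n i) \<and> k = n - m"
    then show "m + k = n"
      by (intro poly_mapping_eqI) (simp add: lookup_add lookup_minus)
  qed
  with add show ?case
    by (auto simp: distrib_left lookup_add mult_single lookup_single when_def algebra_simps)
qed simp

text \<open>A Cartier map \<open>\<phi>\<close> is \<open>2\<^sup>-\<^sup>e\<close>-linear and preserves the ideal \<open>(f)\<close>. It therefore acts on the local
  ring and sends the Frobenius power \<open>I\<^sup>[\<^sup>q\<^sup>]\<close> into \<open>I\<close>; so \<open>c u\<^sup>q \<in> I\<^sup>[\<^sup>q\<^sup>]\<close> implies \<open>\<phi>(c) u \<in> I\<close>.\<close>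

definition cartier_map :: "nat \<Rightarrow> ('k::field poly5 \<Rightarrow> 'k poly5) \<Rightarrow> bool" where
  "cartier_map e \<phi> \<longleftrightarrow> (\<forall>a b. \<phi> (a + b) = \<phi> a + \<phi> b) \<and>
     (\<forall>a b. \<phi> (a ^ (2 ^ e) * b) = a * \<phi> b) \<and> (\<forall>a. fermat_quintic dvd \<phi> (fermat_quintic * a))"

locale frobenius_functional =
  fixes e :: nat and \<mu> :: "'k::field \<Rightarrow> 'k"
  assumes char: "CHAR('k) = 2"
    and add: "\<mu> (a + b) = \<mu> a + \<mu> b"
    and mult: "\<mu> (a ^ (2 ^ e) * b) = a * \<mu> b"
begin

lemma zero [simp]: "\<mu> 0 = 0"
  using mult[of 0 0] by simp

text \<open>For perfect k and q = 2^e this is the coordinate of the q-th root of p at the basis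
  monomial x^(\<open>\<rho>\<close>/q): c x^(qn + \<open>\<rho>\<close>) goes to
  \<open>\<mu>\<close> c x^n, and all other exponent classes are discarded.\<close>

definition coeff_root :: "(5 \<Rightarrow>\<^sub>0 nat) \<Rightarrow> 'k poly5 \<Rightarrow> 'k poly5" where
  "coeff_root \<rho> p = Poly_Mapping.map \<mu> (Poly_Mapping.map_key (\<lambda>n. stretch (2 ^ e) n + \<rho>) p)"

lemma lookup_coeff_root: "lookup (coeff_root \<rho> p) n = \<mu> (lookup p (stretch (2 ^ e) n + \<rho>))"
proof -
  have "inj (\<lambda>n. stretch (2 ^ e) n + \<rho>)"
    by (rule injI) (auto simp: poly_mapping_eq_iff fun_eq_iff lookup_add)
  then show ?thesis
    by (simp add: coeff_root_def Poly_Mapping.map.rep_eq map_key.rep_eq when_def)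
qed

lemma coeff_root_add: "coeff_root \<rho> (p + q) = coeff_root \<rho> p + coeff_root \<rho> q"
  by (rule poly_mapping_eqI) (simp add: lookup_coeff_root lookup_add add)

lemma coeff_root_0 [simp]: "coeff_root \<rho> 0 = 0"
  by (rule poly_mapping_eqI) (simp add: lookup_coeff_root)

lemma coeff_root_power_mult:
  assumes \<rho>: "\<And>i. lookup \<rho> i < 2 ^ e"
  shows "coeff_root \<rho> (a ^ (2 ^ e) * p) = a * coeff_root \<rho> p"
proof (induction a rule: poly_mapping_single_induct)
  case zero
  then show ?case by (simp add: power_0_left)
next
  case (add m c a)
  have "coeff_root \<rho> (single m c ^ (2 ^ e) * p) = single m c * coeff_root \<rho> p"
  proof (rule poly_mapping_eqI)
    fix n
    let ?q = "2 ^ e :: nat"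
    \<comment> \<open>As \<open>\<rho>\<close> stays below q, the exponent qn +
      \<open>\<rho>\<close> is a division with remainder, so divisibility by x^(qm) depends on n
      alone.\<close>
    have le: "?q * lookup m i \<le> ?q * lookup n i + lookup \<rho> i \<longleftrightarrow> lookup m i \<le> lookup n i" for i
    proof
      assume "?q * lookup m i \<le> ?q * lookup n i + lookup \<rho> i"
      also have "\<dots> < ?q * (lookup n i + 1)" using \<rho>[of i] by simp
      finally show "lookup m i \<le> lookup n i" by (simp only: mult_less_cancel1) simp
    qed (simp add: trans_le_add1)
    have "stretch ?q n + \<rho> - stretch ?q m = stretch ?q (n - m) + \<rho>" if "\<forall>i. lookup m i \<le> lookup n i"
      using that by (intro poly_mapping_eqI) (simp add: lookup_add lookup_minus diff_mult_distrib2)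
    then show "lookup (coeff_root \<rho> (single m c ^ ?q * p)) n = lookup (single m c * coeff_root \<rho> p) n"
      unfolding lookup_coeff_root power_single lookup_single_mult lookup_add lookup_stretch le
      by (simp add: mult)
  qed
  with add show ?case
    by (simp add: char2_power_add[OF char2_poly5[OF char]] distrib_right coeff_root_add)
qed

text \<open>Premultiplication by f^(q-1) is Fedder's device: a factor f of the argument completes it
  to f^q, which leaves the map as f.\<close>

lemma cartier_map_coeff_root:
  assumes "\<And>i. lookup \<rho> i < 2 ^ e"
  shows "cartier_map e (\<lambda>p. coeff_root \<rho> (fermat_quintic ^ (2 ^ e - 1) * p))"
  unfolding cartier_map_def
proof (intro conjI allI)
  fix a b :: "'k poly5"
  show "coeff_root \<rho> (fermat_quintic ^ (2 ^ e - 1) * (a + b))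
      = coeff_root \<rho> (fermat_quintic ^ (2 ^ e - 1) * a) + coeff_root \<rho> (fermat_quintic ^ (2 ^ e - 1) * b)"
    by (simp add: distrib_left coeff_root_add)
  show "coeff_root \<rho> (fermat_quintic ^ (2 ^ e - 1) * (a ^ 2 ^ e * b))
      = a * coeff_root \<rho> (fermat_quintic ^ (2 ^ e - 1) * b)"
    using coeff_root_power_mult[OF assms, of a "fermat_quintic ^ (2 ^ e - 1) * b"]
    by (simp add: algebra_simps)
  have "fermat_quintic ^ (2 ^ e - 1) * fermat_quintic = (fermat_quintic :: 'k poly5) ^ 2 ^ e"
    by (rule power_minus_mult) simp
  then have "fermat_quintic ^ (2 ^ e - 1) * (fermat_quintic * a) = fermat_quintic ^ 2 ^ e * a"
    by (simp only: mult.assoc[symmetric])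
  then show "fermat_quintic dvd coeff_root \<rho> (fermat_quintic ^ (2 ^ e - 1) * (fermat_quintic * a))"
    by (simp only: coeff_root_power_mult[OF assms] dvd_triv_left)
qed

end

definition halve :: "(5 \<Rightarrow>\<^sub>0 nat) \<Rightarrow> (5 \<Rightarrow>\<^sub>0 nat)" where
  "halve m = Poly_Mapping.map (\<lambda>k. k div 2) m"

lemma lookup_halve [simp]: "lookup (halve m) i = lookup m i div 2"
  by (simp add: halve_def Poly_Mapping.map.rep_eq when_def)

text \<open>Among the products of the monomial with the terms \<open>x\<^sub>l\<^sup>5\<close>, the one with \<open>l = k\<close> is determined by
  its exponents modulo 2.\<close>

lemma exists_cartier_map_halve:
  assumes char: "CHAR('k::field) = 2"
  obtains \<phi> :: "'k::field poly5 \<Rightarrow> 'k poly5"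
    where "cartier_map 1 \<phi>" "\<phi> (single m 1) = single (halve (single k 5 + m)) 1"
proof -
  obtain \<mu> :: "'k \<Rightarrow> 'k" where \<mu>: "\<And>a b. \<mu> (a + b) = \<mu> a + \<mu> b"
    "\<And>a b. \<mu> (a ^ (2 ^ 1) * b) = a * \<mu> b" "\<mu> 1 = 1"
    by (rule exists_frobenius_functional[OF char2_field[OF char] one_neq_zero, where e = 1]) (rule that)
  interpret frobenius_functional 1 \<mu>
    by unfold_locales (use char \<mu> in auto)
  let ?M = "single k 5 + m"
  define \<rho> where "\<rho> = ?M - stretch 2 (halve ?M)"
  have \<rho>: "lookup \<rho> i = lookup ?M i mod 2" for i
    unfolding \<rho>_def by (simp add: lookup_minus minus_mult_div_eq_mod)
  have iff: "single l 5 + m = stretch (2 ^ 1) n + \<rho> \<longleftrightarrow> l = k \<and> n = halve ?M" for l n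
  proof
    assume *: "single l 5 + m = stretch (2 ^ 1) n + \<rho>"
    have **: "lookup (single l 5 + m) i = 2 * lookup n i + lookup ?M i mod 2" for i
      unfolding * by (simp add: lookup_add \<rho>)
    \<comment> \<open>Adding 5 flips the parity of the exponent of x_k. For l distinct from k that
      exponent keeps the parity it has in m, so the term lies outside the class of
      \<open>\<rho>\<close>.\<close>
    have "l = k"
    proof (rule ccontr)
      assume "l \<noteq> k"
      with **[of k] have "lookup m k = 2 * lookup n k + (5 + lookup m k) mod 2"
        by (simp add: lookup_add lookup_single)
      then show False by arith
    qed
    moreover have "lookup n i = lookup (halve ?M) i" for i
      using **[of i] unfolding \<open>l = k\<close> lookup_halve by linarith
    ultimately show "l = k \<and> n = halve ?M" by (auto intro: poly_mapping_eqI)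
  next
    assume "l = k \<and> n = halve ?M"
    then show "single l 5 + m = stretch (2 ^ 1) n + \<rho>"
      by (intro poly_mapping_eqI) (simp only: \<rho> lookup_add lookup_stretch lookup_halve, simp)
  qed
  have "coeff_root \<rho> (fermat_quintic ^ (2 ^ 1 - 1) * single m 1) = single (halve ?M) 1"
  proof (rule poly_mapping_eqI)
    fix n
    have "lookup (fermat_quintic ^ (2 ^ 1 - 1) * single m 1) (stretch (2 ^ 1) n + \<rho>)
        = (\<Sum>l\<in>UNIV. (1::'k) when single l 5 + m = stretch (2 ^ 1) n + \<rho>)"
      by (simp add: fermat_quintic_eq sum_distrib_right mult_single lookup_sum lookup_single)
    also have "\<dots> = (1 when n = halve ?M)"
      by (cases "n = halve ?M") (simp_all only: iff, simp_all add: when_def)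
    finally show "lookup (coeff_root \<rho> (fermat_quintic ^ (2 ^ 1 - 1) * single m 1)) n
        = lookup (single (halve ?M) 1) n"
      unfolding lookup_coeff_root using \<mu>(3) by (auto simp: lookup_single when_def)
  qed
  moreover have "lookup \<rho> i < 2 ^ 1" for i
    by (simp add: \<rho>)
  ultimately show ?thesis
    using that cartier_map_coeff_root by blast
qed

text \<open>Since all binomial coefficients \<open>2\<^sup>e - 1\<close> over \<open>j\<close> are odd, \<open>(z\<^sup>5 + g)\<^sup>q\<^sup>-\<^sup>1\<close> contains every
  \<open>z\<^sup>5\<^sup>j g\<^sup>q\<^sup>-\<^sup>1\<^sup>-\<^sup>j\<close>, but only \<open>j = q - 1\<close> contributes to the coefficients at exponents of \<open>z\<close>
  congruent to \<open>-5\<close> modulo \<open>q\<close>.\<close>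

lemma exists_cartier_map_free_of:
  fixes b :: "'k::field poly5"
  assumes char: "CHAR('k) = 2" and b: "b \<noteq> 0" "free_of z b"
  obtains e0 where "\<And>e. e \<ge> e0 \<Longrightarrow> \<exists>\<phi>. cartier_map e \<phi> \<and> \<phi> b = poly_var z ^ 4"
proof -
  have char2: "(2 :: 'k poly5) = 0" using char by (rule char2_poly5)
  define N where "N = Max ((\<lambda>(m, i). lookup m i) ` (keys b \<times> UNIV))"
  have N: "lookup m i \<le> N" if "m \<in> keys b" for m i
    unfolding N_def by (rule Max_ge) (use that in auto)
  obtain a where a: "a \<in> keys b" using b(1) using keys_eq_empty by blast
  then have ba: "lookup b a \<noteq> 0" by (simp add: in_keys_iff)
  \<comment> \<open>The bound gives q > N + 7. Hence all exponents of b are proper remainders modulo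
    q, and q - 5 is not truncated.\<close>
  have "\<exists>\<phi>. cartier_map e \<phi> \<and> \<phi> b = poly_var z ^ 4" if e: "e \<ge> N + 3" for e
  proof -
    define q :: nat where "q = 2 ^ e"
    have "q \<ge> 2 ^ (N + 3)" unfolding q_def using e by (rule power_increasing) simp
    moreover have "2 ^ (N + 3) = 8 * (2 ^ N :: nat)" by (simp add: power_add)
    moreover have "N < 2 ^ N" by (rule less_exp)
    ultimately have q: "q > N + 7" by linarith
    obtain \<mu> :: "'k \<Rightarrow> 'k" where \<mu>: "\<And>a b. \<mu> (a + b) = \<mu> a + \<mu> b"
      "\<And>a b. \<mu> (a ^ (2 ^ e) * b) = a * \<mu> b" "\<mu> (lookup b a) = 1"
      by (rule exists_frobenius_functional[OF char2_field[OF char] ba, where e = e]) (rule that)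
    interpret frobenius_functional e \<mu>
      by unfold_locales (use char \<mu> in auto)
    \<comment> \<open>The remainder q - 5 selects z^(5(q-1)), because 5(q-1) = 4q + (q-5). The
      quotient 4 is the exponent in the result; a is a monomial of b whose coefficient
      \<open>\<mu>\<close> sends to 1.\<close>
    define \<rho> where "\<rho> = a + single z (q - 5)"
    have az: "lookup a z = 0" using a b(2) by (simp add: free_of_def)
    have \<rho>: "lookup \<rho> i = (if i = z then q - 5 else lookup a i)" for i
      using az by (auto simp: \<rho>_def lookup_add lookup_single)
    obtain g where g: "(fermat_quintic :: 'k poly5) = poly_var z ^ 5 + g" "free_of z g"
      by (rule fermat_quintic_split)
    let ?f = "fermat_quintic :: 'k poly5" and ?z = "poly_var z :: 'k poly5"
    \<comment> \<open>No binomial coefficient is computed: f^q = (z^5)^q - g^q is a difference of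
      powers divisible by z^5 - g = f, and cancelling f leaves a geometric sum.\<close>
    have "?f * ?f ^ (q - 1) = ?f ^ q"
      using q by (cases q) auto
    also have "\<dots> = (?z ^ 5) ^ q - g ^ q"
      unfolding g(1) q_def by (simp add: char2_power_add[OF char2] char2_minus[OF char2])
    also have "\<dots> = (?z ^ 5 - g) * (\<Sum>j<q. g ^ (q - Suc j) * (?z ^ 5) ^ j)"
      by (rule power_diff_sumr2)
    also have "?z ^ 5 - g = ?f" by (simp add: g(1) char2_minus[OF char2])
    finally have "?f ^ (q - 1) = (\<Sum>j<q. g ^ (q - Suc j) * (?z ^ 5) ^ j)"
      using fermat_quintic_neq_0 by simp
    moreover have zpow: "(?z ^ 5) ^ j = single (single z (5 * j)) 1" for j
      unfolding power_mult[symmetric] by (rule poly_var_power)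
    ultimately have expand: "?f ^ (q - 1) * b = (\<Sum>j<q. single (single z (5 * j)) 1 * (g ^ (q - Suc j) * b))"
      by (simp add: sum_distrib_left zpow algebra_simps)
    have term0: "lookup (single (single z (5 * j)) 1 * (g ^ (q - Suc j) * b)) (stretch q n + \<rho>) = 0"
      if "5 * j \<noteq> q * lookup n z + (q - 5)" for j n
    proof -
      let ?M = "stretch q n + \<rho>"
      have M: "lookup ?M z = q * lookup n z + (q - 5)" by (simp add: lookup_add \<rho>)
      have "free_of z (g ^ (q - Suc j) * b)"
        by (intro free_of_mult free_of_power g b)
      then have "lookup (g ^ (q - Suc j) * b) m = 0" if "lookup m z \<noteq> 0" for m
        using that unfolding free_of_def by (meson not_in_keys_iff_lookup_eq_zero)
      moreover have "lookup (?M - single z (5 * j)) z \<noteq> 0" if "5 * j \<le> lookup ?M z"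
        using that \<open>5 * j \<noteq> _\<close> M by (simp add: lookup_minus)
      ultimately show ?thesis
        unfolding lookup_single_mult
        by (auto simp: lookup_single when_def split: if_splits)
    qed
    have coeff: "lookup (?f ^ (q - 1) * b) (stretch q n + \<rho>) = (lookup b a when n = single z 4)" for n
    proof (cases "\<exists>j<q. 5 * j = q * lookup n z + (q - 5)")
      case False
      have "n \<noteq> single z 4"
      proof
        assume "n = single z 4"
        then have "5 * (q - 1) = q * lookup n z + (q - 5)" "q - 1 < q" using q by auto
        with False show False by blast
      qed
      moreover have "lookup (?f ^ (q - 1) * b) (stretch q n + \<rho>) = 0"
        unfolding expand lookup_sum using False by (intro sum.neutral) (auto intro!: term0)
      ultimately show ?thesis by simp
    next
      case True
      then obtain j where j: "j < q" "5 * j = q * lookup n z + (q - 5)" by blast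
      then have eq: "5 * (j + 1) = q * (lookup n z + 1)" using q by simp
      then have "q dvd 5 * (j + 1)" by simp
      moreover have "coprime q 5" by (simp add: q_def)
      ultimately have "q dvd j + 1" using coprime_dvd_mult_right_iff by blast
      then have "j + 1 = q" using j(1) by (metis Suc_eq_plus1 Suc_leI dvd_imp_le le_antisym zero_less_Suc)
      then have nz: "lookup n z = 4" and j': "j = q - 1" using eq q by auto
      have "lookup (?f ^ (q - 1) * b) (stretch q n + \<rho>)
          = (\<Sum>j\<in>{q - 1}. lookup (single (single z (5 * j)) 1 * (g ^ (q - Suc j) * b)) (stretch q n + \<rho>))"
        unfolding expand lookup_sum
      proof (rule sum.mono_neutral_right)
        show "\<forall>i\<in>{..<q} - {q - 1}. lookup (single (single z (5 * i)) 1 * (g ^ (q - Suc i) * b)) (stretch q n + \<rho>) = 0"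
          using j(2) j' by (auto intro!: term0)
      qed (use q in auto)
      also have "\<dots> = lookup b (stretch q n + \<rho> - single z (5 * (q - 1)))"
        using q j(2) unfolding j' by (auto simp: lookup_single_mult lookup_add lookup_single \<rho> when_def)
      also have "\<dots> = (lookup b a when n = single z 4)"
      proof (cases "n = single z 4")
        case True
        have "stretch q n + \<rho> - single z (5 * (q - 1)) = a"
          using q az unfolding True
          by (intro poly_mapping_eqI) (auto simp: lookup_add lookup_minus lookup_single \<rho> when_def)
        with True show ?thesis by simp
      next
        case False
        \<comment> \<open>Since n has exponent 4 at z, it differs from the target at another
          variable. There its positive exponent is multiplied by q and exceeds every exponent in
          b.\<close>
        then obtain i where i: "lookup n i \<noteq> lookup (single z 4) i" by (metis poly_mapping_eqI)
        then have "i \<noteq> z" "lookup n i > 0" using nz by (auto simp: lookup_single when_def split: if_splits)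
        then have "lookup (stretch q n + \<rho> - single z (5 * (q - 1))) i \<ge> q"
          by (simp add: lookup_add lookup_minus lookup_single trans_le_add1)
        then have "stretch q n + \<rho> - single z (5 * (q - 1)) \<notin> keys b"
          using N[of "stretch q n + \<rho> - single z (5 * (q - 1))" i] q by linarith
        with False show ?thesis by (simp add: in_keys_iff)
      qed
      finally show ?thesis .
    qed
    have "coeff_root \<rho> (?f ^ (2 ^ e - 1) * b) = poly_var z ^ 4"
      by (rule poly_mapping_eqI)
        (use coeff \<mu>(3) in \<open>auto simp: lookup_coeff_root poly_var_power lookup_single when_def simp flip: q_def\<close>)
    moreover have "lookup \<rho> i < 2 ^ e" for i
      using N[OF a, of i] q by (simp add: \<rho> flip: q_def)
    ultimately show ?thesis
      using cartier_map_coeff_root by blast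
  qed
  then show ?thesis using that by blast
qed


section \<open>The local ring as fractions of polynomials\<close>

abbreviation const :: "'k::field poly5 \<Rightarrow> 'k" where
  "const p \<equiv> lookup p 0"

lemma const_mult: "const (p * q) = const p * const q"
proof (induction p rule: poly_mapping_single_induct)
  case (add m c p)
  have "(\<forall>i. lookup m i = 0) \<longleftrightarrow> m = 0"
    by (metis lookup_zero poly_mapping_eqI)
  with add show ?case
    by (auto simp: distrib_right lookup_add lookup_single_mult lookup_single when_def)
qed simp

lemma const_power: "const (p ^ n) = const p ^ n"
  by (induction n) (simp_all add: const_mult)

lemma single_0_iff: "single i n = 0 \<longleftrightarrow> n = (0::nat)"
  by (metis lookup_single_eq lookup_zero single_zero)

lemma const_poly_var: "const (poly_var i) = 0"
  by (simp add: poly_var_def lookup_single single_0_iff when_def)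

lemma const_fermat_quintic: "const fermat_quintic = 0"
  unfolding fermat_quintic_def by (simp add: lookup_sum const_power const_poly_var)

lemma poly5_ring_simps [simp]:
  "carrier poly5_ring = UNIV" "a \<otimes>\<^bsub>poly5_ring\<^esub> b = a * b" "a \<oplus>\<^bsub>poly5_ring\<^esub> b = a + b"
  "\<one>\<^bsub>poly5_ring\<^esub> = 1" "\<zero>\<^bsub>poly5_ring\<^esub> = 0"
  by (simp_all add: ring_of_type_algebra_def)

lemma cring_poly5_ring: "cring (poly5_ring :: 'k::field poly5 ring)"
  by (rule cring_from_type_algebra)

lemma a_inv_poly5_ring [simp]: "\<ominus>\<^bsub>poly5_ring\<^esub> a = - (a :: 'k::field poly5)"
proof -
  interpret cring "poly5_ring :: 'k poly5 ring" by (rule cring_poly5_ring)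
  show ?thesis by (rule minus_equality) auto
qed

lemma fermat_ideal_eq: "fermat_ideal = {p :: 'k::field poly5. fermat_quintic dvd p}"
proof -
  interpret cring "poly5_ring :: 'k poly5 ring" by (rule cring_poly5_ring)
  have "fermat_ideal = PIdl\<^bsub>poly5_ring\<^esub> (fermat_quintic :: 'k poly5)"
    unfolding fermat_ideal_def by (simp add: cgenideal_eq_genideal)
  then show ?thesis
    by (auto simp: cgenideal_def dvd_def mult.commute)
qed

lemma ideal_fermat_ideal: "ideal fermat_ideal (poly5_ring :: 'k::field poly5 ring)"
proof -
  interpret cring "poly5_ring :: 'k poly5 ring" by (rule cring_poly5_ring)
  show ?thesis unfolding fermat_ideal_def by (rule genideal_ideal) simp
qed

definition cls :: "'k::field poly5 \<Rightarrow> 'k poly5 set" where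
  "cls a = fermat_ideal +>\<^bsub>poly5_ring\<^esub> a"

lemma cls_eq_iff: "cls a = cls b \<longleftrightarrow> fermat_quintic dvd a - (b :: 'k::field poly5)"
proof -
  interpret cring "poly5_ring :: 'k poly5 ring" by (rule cring_poly5_ring)
  show ?thesis
    using quotient_eq_iff_same_a_r_cos[OF ideal_fermat_ideal, of a b]
    by (auto simp: cls_def a_minus_def fermat_ideal_eq)
qed

lemma ring_hom_cring_cls: "ring_hom_cring poly5_ring fermat_quotient (cls :: 'k::field poly5 \<Rightarrow> _)"
  using ideal.rcos_ring_hom_cring[OF ideal_fermat_ideal cring_poly5_ring]
  unfolding fermat_quotient_def cls_def[abs_def] .

lemma cls_simps:
  fixes a b :: "'k::field poly5"
  shows "cls a \<otimes>\<^bsub>fermat_quotient\<^esub> cls b = cls (a * b)" "cls a \<oplus>\<^bsub>fermat_quotient\<^esub> cls b = cls (a + b)"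
    "\<one>\<^bsub>fermat_quotient\<^esub> = cls (1 :: 'k poly5)" "\<zero>\<^bsub>fermat_quotient\<^esub> = cls (0 :: 'k poly5)"
    "\<ominus>\<^bsub>fermat_quotient\<^esub> cls a = cls (- a)" "cls a \<ominus>\<^bsub>fermat_quotient\<^esub> cls b = cls (a - b)"
proof -
  interpret ring_hom_cring poly5_ring fermat_quotient "cls :: 'k poly5 \<Rightarrow> _"
    by (rule ring_hom_cring_cls)
  show "cls a \<otimes>\<^bsub>fermat_quotient\<^esub> cls b = cls (a * b)" "cls a \<oplus>\<^bsub>fermat_quotient\<^esub> cls b = cls (a + b)"
    "\<one>\<^bsub>fermat_quotient\<^esub> = cls (1 :: 'k poly5)" "\<zero>\<^bsub>fermat_quotient\<^esub> = cls (0 :: 'k poly5)"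
    using hom_mult[of a b] hom_add[of a b] hom_one hom_zero by simp_all
  have *: "\<ominus>\<^bsub>fermat_quotient\<^esub> cls c = cls (- c)" for c :: "'k poly5"
    using hom_a_inv[of c] by simp
  show "\<ominus>\<^bsub>fermat_quotient\<^esub> cls a = cls (- a)" by (rule *)
  show "cls a \<ominus>\<^bsub>fermat_quotient\<^esub> cls b = cls (a - b)"
    using hom_add[of a "- b"] by (simp add: a_minus_def *)
qed

lemma carrier_fermat_quotient: "carrier fermat_quotient = Set.range (cls :: 'k::field poly5 \<Rightarrow> _)"
  by (auto simp: fermat_quotient_def FactRing_def A_RCOSETS_def' cls_def)

lemma (in cring) ideal_criterion:
  assumes sub: "I \<subseteq> carrier R" and zero: "\<zero> \<in> I"
    and add: "\<And>a b. a \<in> I \<Longrightarrow> b \<in> I \<Longrightarrow> a \<oplus> b \<in> I"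
    and mult: "\<And>a r. a \<in> I \<Longrightarrow> r \<in> carrier R \<Longrightarrow> r \<otimes> a \<in> I"
  shows "ideal I R"
proof (rule idealI)
  show "ring R" by (rule ring_axioms)
  show "subgroup I (add_monoid R)"
  proof (rule add.subgroupI)
    show "\<ominus> a \<in> I" if "a \<in> I" for a
      using mult[OF that, of "\<ominus> \<one>"] that sub by (auto simp: l_minus)
  qed (use sub zero add in auto)
  show "x \<otimes> a \<in> I" if "a \<in> I" "x \<in> carrier R" for a x
    using mult that by blast
  show "a \<otimes> x \<in> I" if "a \<in> I" "x \<in> carrier R" for a x
    using mult[OF that] that sub by (metis m_comm subsetD)
qed

lemma quotient_max_eq: "quotient_max = cls ` {a :: 'k::field poly5. const a = 0}"
proof -
  interpret A: cring "fermat_quotient :: 'k poly5 set ring"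
    by (rule ring_hom_cring.axioms(2)[OF ring_hom_cring_cls])
  have var: "quotient_var i = cls (poly_var i)" for i
    by (simp add: quotient_var_def cls_def)
  let ?M = "cls ` {a :: 'k poly5. const a = 0}"
  have sub: "Set.range quotient_var \<subseteq> carrier (fermat_quotient :: 'k poly5 set ring)"
    by (auto simp: carrier_fermat_quotient var)
  have M: "ideal ?M fermat_quotient"
  proof (rule A.ideal_criterion)
    show "?M \<subseteq> carrier fermat_quotient" by (auto simp: carrier_fermat_quotient)
    show "\<zero>\<^bsub>fermat_quotient\<^esub> \<in> ?M" by (auto simp: cls_simps)
    show "a \<oplus>\<^bsub>fermat_quotient\<^esub> b \<in> ?M" if "a \<in> ?M" "b \<in> ?M" for a b
      using that by (auto simp: cls_simps lookup_add intro!: imageI)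
    show "r \<otimes>\<^bsub>fermat_quotient\<^esub> a \<in> ?M" if "a \<in> ?M" "r \<in> carrier fermat_quotient" for a r
      using that by (auto simp: carrier_fermat_quotient cls_simps const_mult intro!: imageI)
  qed
  show ?thesis
  proof
    show "quotient_max \<subseteq> ?M"
      unfolding quotient_max_def by (rule A.genideal_minimal[OF M]) (auto simp: var const_poly_var)
    have Q: "ideal quotient_max (fermat_quotient :: 'k poly5 set ring)"
      unfolding quotient_max_def by (rule A.genideal_ideal[OF sub])
    have "cls a \<in> quotient_max" if "const a = 0" for a :: "'k poly5"
      using that
    proof (induction a rule: poly_mapping_single_induct)
      case zero
      then show ?case
        using additive_subgroup.zero_closed[OF ideal.axioms(1)[OF Q]] by (simp add: cls_simps)
    next
      case (add m c p)
      have "m \<noteq> 0"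
      proof
        assume "m = 0"
        then have "const p = 0" using add.hyps(2) by (simp add: in_keys_iff)
        with add.prems add.hyps(1) \<open>m = 0\<close> show False by (simp add: lookup_add)
      qed
      then have "const p = 0"
        using add.prems by (simp add: lookup_add lookup_single when_def)
      from \<open>m \<noteq> 0\<close> obtain i where i: "lookup m i \<noteq> 0" by (metis lookup_zero poly_mapping_eqI)
      have "m - single i 1 + single i 1 = m"
      proof (rule poly_mapping_eqI)
        show "lookup (m - single i 1 + single i 1) j = lookup m j" for j
          using i by (cases "j = i") (simp_all add: lookup_add lookup_minus lookup_single)
      qed
      then have sing: "single (m - single i 1) c * poly_var i = single m c"
        by (simp only: poly_var_def mult_single mult_1_right)
      have "cls (single m c) = cls (single (m - single i 1) c) \<otimes>\<^bsub>fermat_quotient\<^esub> quotient_var i"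
        unfolding var cls_simps(1) sing ..
      also have "\<dots> \<in> quotient_max"
      proof (rule ideal.I_l_closed[OF Q])
        show "(quotient_var i :: 'k poly5 set) \<in> quotient_max"
          unfolding quotient_max_def by (rule subsetD[OF A.genideal_self[OF sub] rangeI])
      qed (auto simp: carrier_fermat_quotient)
      finally have "cls (single m c) \<in> quotient_max" .
      from additive_subgroup.a_closed[OF ideal.axioms(1)[OF Q] this add.IH[OF \<open>const p = 0\<close>]]
      show ?case by (simp add: cls_simps)
    qed
    then show "?M \<subseteq> quotient_max" by blast
  qed
qed

lemma denominators_eq:
  "carrier fermat_quotient - quotient_max = cls ` {s :: 'k::field poly5. const s \<noteq> 0}"
proof -
  \<comment> \<open>The constant term is well defined on classes because f has none.\<close>
  have "const a = const b" if "cls a = cls b" for a b :: "'k poly5"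
  proof -
    from that obtain h where h: "a - b = fermat_quintic * h"
      unfolding cls_eq_iff by (elim dvdE)
    have "const (a - b) = 0" unfolding h by (simp add: const_mult const_fermat_quintic)
    then show ?thesis by (simp add: lookup_minus)
  qed
  then have *: "cls s \<in> quotient_max \<longleftrightarrow> const s = 0" for s :: "'k poly5"
    unfolding quotient_max_eq by (metis (mono_tags, lifting) imageE imageI mem_Collect_eq)
  show ?thesis
  proof (intro equalityI subsetI)
    fix x :: "'k poly5 set" assume "x \<in> carrier fermat_quotient - quotient_max"
    then obtain s where "x = cls s" "cls s \<notin> quotient_max"
      unfolding carrier_fermat_quotient by blast
    then show "x \<in> cls ` {s. const s \<noteq> 0}" using *[of s] by (intro image_eqI) simp_all
  next
    fix x :: "'k poly5 set" assume "x \<in> cls ` {s. const s \<noteq> 0}"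
    then obtain s where "x = cls s" "const s \<noteq> 0" by blast
    then show "x \<in> carrier fermat_quotient - quotient_max"
      using *[of s] by (simp add: carrier_fermat_quotient)
  qed
qed

lemma cls_in_denominators_iff:
  "cls s \<in> carrier fermat_quotient - quotient_max \<longleftrightarrow> const (s :: 'k::field poly5) \<noteq> 0"
proof
  assume "cls s \<in> carrier fermat_quotient - quotient_max"
  then have "cls s \<notin> quotient_max" by simp
  then show "const s \<noteq> 0" unfolding quotient_max_eq by blast
qed (use denominators_eq in blast)

lemma mem_loc_frac_iff:
  "(b, t) \<in> loc_frac A S a s \<longleftrightarrow> a \<in> carrier A \<and> s \<in> S \<and> b \<in> carrier A \<and> t \<in> S \<and>
     (\<exists>u\<in>S. u \<otimes>\<^bsub>A\<^esub> (a \<otimes>\<^bsub>A\<^esub> t \<ominus>\<^bsub>A\<^esub> b \<otimes>\<^bsub>A\<^esub> s) = \<zero>\<^bsub>A\<^esub>)"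
  by (simp add: loc_frac_def loc_rel_def)

definition fr :: "'k::field poly5 \<Rightarrow> 'k poly5 \<Rightarrow> 'k fermat_elem" where
  "fr a s = loc_frac fermat_quotient (carrier fermat_quotient - quotient_max) (cls a) (cls s)"

lemma local_var_eq: "local_var i = fr (poly_var i) 1"
  by (simp add: local_var_def fr_def quotient_var_def cls_def[symmetric] cls_simps)

section \<open>Arithmetic of fractions in the local ring\<close>

locale fermat_char2 =
  fixes k_type :: "'k::field itself"
  assumes char: "CHAR('k) = 2"
begin

abbreviation R :: "'k fermat_elem ring" where "R \<equiv> fermat_local_ring"
abbreviation f :: "'k poly5" where "f \<equiv> fermat_quintic"

lemmas char2 = char2_poly5[OF char]
lemmas f_dvd_mult = fermat_quintic_dvd_mult[OF char]

lemma f_not_dvd_unit: "const s \<noteq> 0 \<Longrightarrow> \<not> f dvd s"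
  by (auto simp: const_mult const_fermat_quintic elim!: dvdE)

lemma f_dvd_unit_mult: "const s \<noteq> 0 \<Longrightarrow> f dvd s * a \<longleftrightarrow> f dvd a"
  using f_dvd_mult f_not_dvd_unit by auto

text \<open>A denominator has nonzero constant term, so the prime f does not divide it. The
  auxiliary factor u in the localization relation can therefore be cancelled, leaving plain
  cross-multiplication modulo f.\<close>

lemma fr_eq:
  assumes "const s \<noteq> 0"
  shows "fr a s = {(cls b, cls t) | b t. const t \<noteq> 0 \<and> f dvd a * t - b * s}"
proof -
  let ?D = "cls ` {s :: 'k poly5. const s \<noteq> 0}"
  have rel: "(\<exists>u\<in>?D. u \<otimes>\<^bsub>fermat_quotient\<^esub>
      (cls a \<otimes>\<^bsub>fermat_quotient\<^esub> cls t \<ominus>\<^bsub>fermat_quotient\<^esub> cls b \<otimes>\<^bsub>fermat_quotient\<^esub> cls s) = \<zero>\<^bsub>fermat_quotient\<^esub>)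
    \<longleftrightarrow> f dvd a * t - b * s" (is "?lhs \<longleftrightarrow> _") for b t :: "'k poly5"
  proof -
    have "?lhs \<longleftrightarrow> (\<exists>u. const u \<noteq> 0 \<and> f dvd u * (a * t - b * s))"
      unfolding cls_simps bex_simps cls_eq_iff by simp
    also have "\<dots> \<longleftrightarrow> (\<exists>u :: 'k poly5. const u \<noteq> 0 \<and> f dvd a * t - b * s)"
      using f_dvd_unit_mult by metis
    also have "\<dots> \<longleftrightarrow> f dvd a * t - b * s"
      using assms by blast
    finally show ?thesis .
  qed
  have mem: "(cls b, cls t) \<in> fr a s \<longleftrightarrow> const t \<noteq> 0 \<and> f dvd a * t - b * s" for b t :: "'k poly5"
  proof -
    have "cls s \<in> ?D" using assms by blast
    moreover have "cls t \<in> ?D \<longleftrightarrow> const t \<noteq> 0"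
      using cls_in_denominators_iff[of t] unfolding denominators_eq .
    ultimately show ?thesis
      unfolding fr_def mem_loc_frac_iff denominators_eq rel by (simp add: carrier_fermat_quotient)
  qed
  have "\<exists>b t. x = (cls b, cls (t :: 'k poly5))" if "x \<in> fr a s" for x
  proof -
    obtain x1 x2 where x: "x = (x1, x2)" by (cases x)
    from that have "x1 \<in> carrier fermat_quotient" "x2 \<in> ?D"
      unfolding x fr_def mem_loc_frac_iff denominators_eq by simp_all
    then show ?thesis unfolding x carrier_fermat_quotient by (elim rangeE imageE) blast
  qed
  note cases = this
  show ?thesis
  proof (intro equalityI subsetI)
    fix x assume x: "x \<in> fr a s"
    then obtain b t where "x = (cls b, cls t)" using cases by blast
    with x mem[of b t] show "x \<in> {(cls b, cls t) | b t. const t \<noteq> 0 \<and> f dvd a * t - b * s}" by blast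
  next
    fix x assume "x \<in> {(cls b, cls t) | b t. const t \<noteq> 0 \<and> f dvd a * t - b * s}"
    then obtain b t where "x = (cls b, cls t)" "const t \<noteq> 0" "f dvd a * t - b * s" by blast
    then show "x \<in> fr a s" using mem[of b t] by simp
  qed
qed

lemma fr_self_mem:
  fixes a s :: "'k poly5"
  assumes "const s \<noteq> 0"
  shows "(cls a, cls s) \<in> fr a s"
  unfolding fr_eq[OF assms] using assms by (intro CollectI exI[of _ a] exI[of _ s]) simp

lemma fr_eq_iff:
  assumes s: "const s \<noteq> 0" and t: "const t \<noteq> 0"
  shows "fr a s = fr b t \<longleftrightarrow> f dvd a * t - b * s"
proof
  assume "fr a s = fr b t"
  then have "(cls b, cls t) \<in> fr a s"
    using fr_self_mem[OF t] by simp
  then obtain b' t' where *: "cls b = cls b'" "cls t = cls t'" "f dvd a * t' - b' * s"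
    unfolding fr_eq[OF s] by blast
  have "a * t - b * s = (a * t' - b' * s) + a * (t - t') - s * (b - b')"
    by (simp add: algebra_simps)
  moreover have "f dvd a * (t - t')" "f dvd s * (b - b')"
    using * by (auto simp: cls_eq_iff)
  ultimately show "f dvd a * t - b * s"
    using *(3) by (metis dvd_add dvd_diff)
next
  have trans: "f dvd b * v - w * t"
    if "f dvd a * t - b * s" "f dvd a * v - w * s" "const s \<noteq> 0" for a b s t v w :: "'k poly5"
  proof -
    have "s * (b * v - w * t) = t * (a * v - w * s) - v * (a * t - b * s)"
      by (simp add: algebra_simps)
    also have "f dvd \<dots>" by (rule dvd_diff[OF dvd_mult[OF that(2)] dvd_mult[OF that(1)]])
    finally show ?thesis using that(3) f_dvd_unit_mult by blast
  qed
  assume *: "f dvd a * t - b * s"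
  then have sym: "f dvd b * s - a * t" by (metis dvd_minus_iff minus_diff_eq)
  show "fr a s = fr b t"
  proof -
    have "f dvd a * v - w * s \<longleftrightarrow> f dvd b * v - w * t" for v w
      using trans[OF * _ s] trans[OF sym _ t] by blast
    then show ?thesis
      unfolding fr_eq[OF s] fr_eq[OF t] by simp
  qed
qed

lemma fr_mem:
  fixes a s :: "'k poly5"
  assumes "const s \<noteq> 0" "z \<in> fr a s"
  obtains b t where "z = (cls b, cls t)" "const t \<noteq> 0" "fr b t = fr a s"
proof -
  from assms(2) obtain b t :: "'k poly5" where "z = (cls b, cls t)" "const t \<noteq> 0" "f dvd a * t - b * s"
    unfolding fr_eq[OF assms(1)] by blast
  then show ?thesis using that fr_eq_iff[OF assms(1)] by metis
qed

text \<open>The operations of the localization are unions over all representatives. This collapses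
  such a union once the value is independent of the representatives.\<close>

lemma UN_fr:
  fixes a b s t :: "'k poly5"
  assumes s: "const s \<noteq> 0" and t: "const t \<noteq> 0"
    and G: "\<And>a' s' b' t'. const s' \<noteq> 0 \<Longrightarrow> fr a' s' = fr a s \<Longrightarrow> const t' \<noteq> 0 \<Longrightarrow>
      fr b' t' = fr b t \<Longrightarrow> G (cls a') (cls s') (cls b') (cls t') = C"
  shows "(\<Union>(a, s)\<in>fr a s. \<Union>(b, t)\<in>fr b t. G a s b t) = C"
proof (rule SUP_eq_const)
  show "fr a s \<noteq> {}" using fr_self_mem[OF s] by blast
  fix x assume "x \<in> fr a s"
  with s obtain a' s' where x: "x = (cls a', cls s')" "const s' \<noteq> 0" "fr a' s' = fr a s"
    by (rule fr_mem)
  have "(\<Union>(b, t)\<in>fr b t. G (cls a') (cls s') b t) = C"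
  proof (rule SUP_eq_const)
    show "fr b t \<noteq> {}" using fr_self_mem[OF t] by blast
    fix y assume "y \<in> fr b t"
    with t obtain b' t' where y: "y = (cls b', cls t')" "const t' \<noteq> 0" "fr b' t' = fr b t"
      by (rule fr_mem)
    show "(case y of (b, t) \<Rightarrow> G (cls a') (cls s') b t) = C"
      unfolding y(1) prod.case by (rule G[OF x(2,3) y(2,3)])
  qed
  then show "(case x of (a, s) \<Rightarrow> \<Union>(b, t)\<in>fr b t. G a s b t) = C"
    unfolding x(1) prod.case .
qed

lemma carrier_R: "carrier R = {fr a s | a s. const s \<noteq> 0}"
proof -
  have "carrier R = {loc_frac fermat_quotient (carrier fermat_quotient - quotient_max) x y | x y.
      x \<in> carrier fermat_quotient \<and> y \<in> carrier fermat_quotient - quotient_max}"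
    unfolding fermat_local_ring_def localization_at_def localization_def quotient_def loc_frac_def
    by auto
  also have "\<dots> = {fr a s | a s. const s \<noteq> 0}"
  proof (intro equalityI subsetI)
    fix z :: "'k fermat_elem" assume "z \<in> {loc_frac fermat_quotient (carrier fermat_quotient - quotient_max) x y | x y.
      x \<in> carrier fermat_quotient \<and> y \<in> carrier fermat_quotient - (quotient_max :: 'k poly5 set set)}"
    then obtain x y where z: "z = loc_frac fermat_quotient (carrier fermat_quotient - quotient_max) x y"
      "x \<in> carrier fermat_quotient" "y \<in> carrier fermat_quotient - (quotient_max :: 'k poly5 set set)"
      by blast
    from z(2) obtain a where a: "x = cls a"
      unfolding carrier_fermat_quotient by blast
    from z(3) obtain s where s: "y = cls s" "const s \<noteq> 0"
      unfolding denominators_eq by blast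
    then show "z \<in> {fr a s | a s. const s \<noteq> 0}"
      unfolding z(1) a fr_def by blast
  next
    fix z :: "'k fermat_elem" assume "z \<in> {fr a s | a s. const s \<noteq> 0}"
    then obtain a s where "z = fr a s" "const s \<noteq> 0" by blast
    moreover from this(2) have "cls s \<in> carrier fermat_quotient - quotient_max"
      by (simp only: cls_in_denominators_iff) simp
    moreover have "cls a \<in> carrier fermat_quotient"
      by (simp add: carrier_fermat_quotient)
    ultimately show "z \<in> {loc_frac fermat_quotient (carrier fermat_quotient - quotient_max) x y | x y.
      x \<in> carrier fermat_quotient \<and> y \<in> carrier fermat_quotient - (quotient_max :: 'k poly5 set set)}"
      unfolding fr_def by blast
  qed
  finally show ?thesis .
qed

lemma fr_in_carrier [simp]: "const s \<noteq> 0 \<Longrightarrow> fr a s \<in> carrier R"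
  unfolding carrier_R by blast

lemma carrierE:
  assumes "r \<in> carrier R"
  obtains a s where "r = fr a s" "const s \<noteq> 0"
  using assms unfolding carrier_R by blast

lemma one_R: "\<one>\<^bsub>R\<^esub> = fr 1 1"
  unfolding fermat_local_ring_def localization_at_def localization_def
  by (simp add: fr_def cls_simps)

lemma zero_R: "\<zero>\<^bsub>R\<^esub> = fr 0 1"
  unfolding fermat_local_ring_def localization_at_def localization_def
  by (simp add: fr_def cls_simps)

lemma mult_R:
  assumes s: "const s \<noteq> 0" and t: "const t \<noteq> 0"
  shows "fr a s \<otimes>\<^bsub>R\<^esub> fr b t = fr (a * b) (s * t)"
proof -
  have "fr (a' * b') (s' * t') = fr (a * b) (s * t)"
    if *: "const s' \<noteq> 0" "fr a' s' = fr a s" "const t' \<noteq> 0" "fr b' t' = fr b t" for a' b' s' t'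
  proof -
    have "f dvd a' * s - a * s'" "f dvd b' * t - b * t'"
      using * s t by (auto simp: fr_eq_iff)
    moreover have "a' * b' * (s * t) - a * b * (s' * t')
        = b' * t * (a' * s - a * s') + a * s' * (b' * t - b * t')"
      by (simp add: algebra_simps)
    ultimately show ?thesis
      using * s t by (simp add: fr_eq_iff const_mult)
  qed
  then have "(\<Union>(a, s)\<in>fr a s. \<Union>(b, t)\<in>fr b t.
      loc_frac fermat_quotient (carrier fermat_quotient - quotient_max)
        (a \<otimes>\<^bsub>fermat_quotient\<^esub> b) (s \<otimes>\<^bsub>fermat_quotient\<^esub> t)) = fr (a * b) (s * t)"
    by (intro UN_fr s t) (simp only: cls_simps fr_def[symmetric])
  then show ?thesis
    unfolding fermat_local_ring_def localization_at_def localization_def by simp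
qed

lemma add_R:
  assumes s: "const s \<noteq> 0" and t: "const t \<noteq> 0"
  shows "fr a s \<oplus>\<^bsub>R\<^esub> fr b t = fr (a * t + b * s) (s * t)"
proof -
  have "fr (a' * t' + b' * s') (s' * t') = fr (a * t + b * s) (s * t)"
    if *: "const s' \<noteq> 0" "fr a' s' = fr a s" "const t' \<noteq> 0" "fr b' t' = fr b t" for a' b' s' t'
  proof -
    have "f dvd a' * s - a * s'" "f dvd b' * t - b * t'"
      using * s t by (auto simp: fr_eq_iff)
    moreover have "(a' * t' + b' * s') * (s * t) - (a * t + b * s) * (s' * t')
        = t' * t * (a' * s - a * s') + s' * s * (b' * t - b * t')"
      by (simp add: algebra_simps)
    ultimately show ?thesis
      using * s t by (simp add: fr_eq_iff const_mult)
  qed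
  then have "(\<Union>(a, s)\<in>fr a s. \<Union>(b, t)\<in>fr b t.
      loc_frac fermat_quotient (carrier fermat_quotient - quotient_max)
        (a \<otimes>\<^bsub>fermat_quotient\<^esub> t \<oplus>\<^bsub>fermat_quotient\<^esub> b \<otimes>\<^bsub>fermat_quotient\<^esub> s)
        (s \<otimes>\<^bsub>fermat_quotient\<^esub> t)) = fr (a * t + b * s) (s * t)"
    by (intro UN_fr s t) (simp only: cls_simps fr_def[symmetric])
  then show ?thesis
    unfolding fermat_local_ring_def localization_at_def localization_def by simp
qed

lemma domain_R: "domain R"
proof (rule domain.intro)
  have "cring R"
  proof (rule cringI)
    show "abelian_group R"
    proof (rule abelian_groupI)
      show "\<exists>y\<in>carrier R. y \<oplus>\<^bsub>R\<^esub> x = \<zero>\<^bsub>R\<^esub>" if "x \<in> carrier R" for x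
        using that
      proof (rule carrierE)
        fix a s assume "x = fr a s" "const s \<noteq> 0"
        then show ?thesis
          by (intro bexI[of _ "fr (- a) s"]) (auto simp: add_R zero_R fr_eq_iff const_mult)
      qed
    qed (auto elim!: carrierE simp: add_R zero_R fr_eq_iff const_mult algebra_simps)
    show "comm_monoid R"
      by (rule comm_monoidI)
        (auto elim!: carrierE simp: mult_R one_R fr_eq_iff const_mult algebra_simps)
    show "(x \<oplus>\<^bsub>R\<^esub> y) \<otimes>\<^bsub>R\<^esub> z = x \<otimes>\<^bsub>R\<^esub> z \<oplus>\<^bsub>R\<^esub> y \<otimes>\<^bsub>R\<^esub> z"
      if "x \<in> carrier R" "y \<in> carrier R" "z \<in> carrier R" for x y z
      using that by (elim carrierE) (simp add: mult_R add_R fr_eq_iff const_mult algebra_simps)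
  qed
  then show "cring R" .
  show "domain_axioms R"
  proof
    show "\<one>\<^bsub>R\<^esub> \<noteq> \<zero>\<^bsub>R\<^esub>"
      using f_not_dvd_unit[of 1] by (simp add: one_R zero_R fr_eq_iff)
    show "a = \<zero>\<^bsub>R\<^esub> \<or> b = \<zero>\<^bsub>R\<^esub>"
      if "a \<otimes>\<^bsub>R\<^esub> b = \<zero>\<^bsub>R\<^esub>" "a \<in> carrier R" "b \<in> carrier R" for a b
      using that by (elim carrierE) (use f_dvd_mult in \<open>simp add: mult_R zero_R fr_eq_iff const_mult\<close>)
  qed
qed

end


section \<open>Ideals of the local ring\<close>

context fermat_char2
begin

sublocale R: domain R by (rule domain_R)

lemma minus_R: "const s \<noteq> 0 \<Longrightarrow> \<ominus>\<^bsub>R\<^esub> fr a s = fr (- a) s"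
  by (rule R.minus_equality) (simp_all add: add_R zero_R fr_eq_iff const_mult)

lemma power_R: "const s \<noteq> 0 \<Longrightarrow> fr a s [^]\<^bsub>R\<^esub> (n::nat) = fr (a ^ n) (s ^ n)"
  by (induction n) (simp_all add: one_R mult_R const_power mult.commute)

text \<open>These are the contractions of ideals of R to the polynomials. With \<open>ext\<close> as
  inverse, ideals of R can be studied without handling fractions.\<close>

definition saturated :: "'k poly5 set \<Rightarrow> bool" where
  "saturated N \<longleftrightarrow> (\<forall>a\<in>N. \<forall>b\<in>N. a + b \<in> N) \<and> (\<forall>a\<in>N. \<forall>r. r * a \<in> N) \<and>
     (\<forall>a. f dvd a \<longrightarrow> a \<in> N) \<and> (\<forall>s a. const s \<noteq> 0 \<and> s * a \<in> N \<longrightarrow> a \<in> N)"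

definition ext :: "'k poly5 set \<Rightarrow> 'k fermat_elem set" where
  "ext N = {fr a s | a s. a \<in> N \<and> const s \<noteq> 0}"

lemma
  assumes "saturated N"
  shows saturated_add: "a \<in> N \<Longrightarrow> b \<in> N \<Longrightarrow> a + b \<in> N"
    and saturated_mult: "a \<in> N \<Longrightarrow> r * a \<in> N"
    and saturated_f: "f dvd a \<Longrightarrow> a \<in> N"
    and saturated_unit: "const s \<noteq> 0 \<Longrightarrow> s * a \<in> N \<Longrightarrow> a \<in> N"
proof -
  note * = assms[unfolded saturated_def]
  show "a \<in> N \<Longrightarrow> b \<in> N \<Longrightarrow> a + b \<in> N" using conjunct1[OF *] by simp
  show "a \<in> N \<Longrightarrow> r * a \<in> N" using conjunct1[OF conjunct2[OF *]] by simp
  show "f dvd a \<Longrightarrow> a \<in> N" using conjunct1[OF conjunct2[OF conjunct2[OF *]]] by simp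
  show "const s \<noteq> 0 \<Longrightarrow> s * a \<in> N \<Longrightarrow> a \<in> N"
    using conjunct2[OF conjunct2[OF conjunct2[OF *]]] by metis
qed

lemma saturated_0: "saturated N \<Longrightarrow> 0 \<in> N"
  by (rule saturated_f) simp_all

lemma fr_mem_ext_iff:
  assumes N: "saturated N" and s: "const s \<noteq> 0"
  shows "fr a s \<in> ext N \<longleftrightarrow> a \<in> N"
proof
  assume "fr a s \<in> ext N"
  then obtain b t where b: "fr a s = fr b t" "b \<in> N" "const t \<noteq> 0"
    unfolding ext_def by blast
  then have "f dvd a * t - b * s" using fr_eq_iff[OF s b(3)] by blast
  then have "(a * t - b * s) + s * b \<in> N"
    by (intro saturated_add[OF N] saturated_f[OF N] saturated_mult[OF N] b)
  then have "t * a \<in> N" by (simp add: algebra_simps)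
  then show "a \<in> N" by (rule saturated_unit[OF N b(3)])
qed (use s in \<open>auto simp: ext_def\<close>)

lemma ext_subset_carrier: "ext N \<subseteq> carrier R"
  unfolding ext_def carrier_R by blast

lemma ideal_ext:
  assumes N: "saturated N"
  shows "ideal (ext N) R"
proof (rule R.ideal_criterion)
  show "\<zero>\<^bsub>R\<^esub> \<in> ext N"
    by (simp add: zero_R fr_mem_ext_iff[OF N] saturated_0[OF N])
  show "x \<oplus>\<^bsub>R\<^esub> y \<in> ext N" if xy: "x \<in> ext N" "y \<in> ext N" for x y
  proof -
    obtain a s b t where x: "x = fr a s" "y = fr b t" "const s \<noteq> 0" "const t \<noteq> 0"
      using xy unfolding ext_def by blast
    then have "a \<in> N" "b \<in> N" using xy fr_mem_ext_iff[OF N] by simp_all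
    then have "t * a + s * b \<in> N" by (intro saturated_add[OF N] saturated_mult[OF N])
    then show ?thesis using x
      by (simp add: add_R fr_mem_ext_iff[OF N] const_mult mult.commute)
  qed
  show "r \<otimes>\<^bsub>R\<^esub> x \<in> ext N" if xr: "x \<in> ext N" "r \<in> carrier R" for x r
  proof -
    obtain a s b t where x: "x = fr a s" "r = fr b t" "const s \<noteq> 0" "const t \<noteq> 0"
      using xr unfolding ext_def carrier_R by blast
    then have "a \<in> N" using xr fr_mem_ext_iff[OF N] by simp
    then show ?thesis using x
      by (simp add: mult_R fr_mem_ext_iff[OF N] const_mult saturated_mult[OF N])
  qed
qed (rule ext_subset_carrier)

lemma saturated_contraction:
  assumes "ideal I R"
  shows "saturated {a. fr a 1 \<in> I}"
proof -
  interpret I: ideal I R by fact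
  have mult: "fr (r * a) 1 \<in> I" if "fr a 1 \<in> I" for a r
    using I.I_l_closed[OF that, of "fr r 1"] by (simp add: mult_R)
  have add: "fr (a + b) 1 \<in> I" if "fr a 1 \<in> I" "fr b 1 \<in> I" for a b
    using I.a_closed[OF that] by (simp add: add_R)
  have dvd: "fr a 1 \<in> I" if "f dvd a" for a
  proof -
    have "fr a 1 = \<zero>\<^bsub>R\<^esub>" using that by (simp add: zero_R fr_eq_iff)
    then show ?thesis by (simp add: I.zero_closed)
  qed
  have unit: "fr a 1 \<in> I" if "const s \<noteq> 0" "fr (s * a) 1 \<in> I" for s a
  proof -
    have "fr 1 s \<otimes>\<^bsub>R\<^esub> fr (s * a) 1 = fr a 1"
      using that(1) by (simp add: mult_R fr_eq_iff mult.commute)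
    then show ?thesis using I.I_l_closed[OF that(2), of "fr 1 s"] that(1) by simp
  qed
  show ?thesis
    unfolding saturated_def
    by (intro conjI ballI allI impI CollectI; (elim conjE CollectE)?) (erule (1) add, erule mult, erule dvd, erule (1) unit)
qed

lemma ext_contraction:
  assumes "ideal I R"
  shows "ext {a. fr a 1 \<in> I} = I"
proof -
  interpret I: ideal I R by fact
  have *: "fr a s \<in> I \<longleftrightarrow> fr a 1 \<in> I" if "const s \<noteq> 0" for a s
  proof
    assume "fr a 1 \<in> I"
    then have "fr 1 s \<otimes>\<^bsub>R\<^esub> fr a 1 \<in> I" using that by (intro I.I_l_closed) simp_all
    then show "fr a s \<in> I" using that by (simp add: mult_R)
  next
    assume "fr a s \<in> I"
    then have "fr s 1 \<otimes>\<^bsub>R\<^esub> fr a s \<in> I" using that by (intro I.I_l_closed) simp_all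
    moreover have "fr s 1 \<otimes>\<^bsub>R\<^esub> fr a s = fr a 1" using that by (simp add: mult_R fr_eq_iff)
    ultimately show "fr a 1 \<in> I" by simp
  qed
  show ?thesis
  proof (intro equalityI subsetI)
    fix x assume "x \<in> ext {a. fr a 1 \<in> I}"
    then show "x \<in> I" unfolding ext_def using * by blast
  next
    fix x assume "x \<in> I"
    moreover from this I.a_subset have "x \<in> carrier R" by blast
    then obtain a s where "x = fr a s" "const s \<noteq> 0" by (rule carrierE)
    ultimately show "x \<in> ext {a. fr a 1 \<in> I}" unfolding ext_def using * by blast
  qed
qed

lemma fr_mem_ideal_iff:
  assumes "ideal I R" "const s \<noteq> 0"
  shows "fr a s \<in> I \<longleftrightarrow> fr a 1 \<in> I"
  using fr_mem_ext_iff[OF saturated_contraction[OF assms(1)] assms(2), of a]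
  unfolding ext_contraction[OF assms(1)] by simp

lemma powers_subset_carrier: "ideal I R \<Longrightarrow> {a [^]\<^bsub>R\<^esub> (n::nat) | a. a \<in> I} \<subseteq> carrier R"
  using ideal.Icarr by fastforce

lemma ideal_frobenius_power: "ideal I R \<Longrightarrow> ideal (frobenius_power R I n) R"
  unfolding frobenius_power_def by (intro R.genideal_ideal powers_subset_carrier)

lemma power_mem_frobenius_power: "ideal I R \<Longrightarrow> a \<in> I \<Longrightarrow> a [^]\<^bsub>R\<^esub> n \<in> frobenius_power R I n"
  unfolding frobenius_power_def using R.genideal_self[OF powers_subset_carrier] by blast

lemma frobenius_power_1:
  assumes "ideal I R"
  shows "frobenius_power R I 1 \<subseteq> I"
  unfolding frobenius_power_def
  using assms ideal.Icarr[OF assms] by (intro R.genideal_minimal) auto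

lemma frobenius_power_mult:
  assumes I: "ideal I R"
  shows "frobenius_power R I (q * q') \<subseteq> frobenius_power R (frobenius_power R I q) q'"
proof -
  have "a [^]\<^bsub>R\<^esub> (q * q') \<in> frobenius_power R (frobenius_power R I q) q'" if "a \<in> I" for a
    using power_mem_frobenius_power[OF ideal_frobenius_power[OF I, of q] power_mem_frobenius_power[OF I that]]
      ideal.Icarr[OF I that] by (simp add: R.nat_pow_pow)
  then show ?thesis
    unfolding frobenius_power_def[of R I "q * q'"]
    by (intro R.genideal_minimal ideal_frobenius_power I) blast
qed


section \<open>Elements of the test ideal\<close>

abbreviation \<tau> :: "'k fermat_elem set" where "\<tau> \<equiv> test_ideal R 2"

text \<open>Exponent e = 0 suffices: if u is in the tight closure of I, then u^q is in that of I^[q]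
  with the same multiplier, because I^[qq'] is contained in (I^[q])^[q'].\<close>

lemma test_ideal_iff:
  "c \<in> \<tau> \<longleftrightarrow> c \<in> carrier R \<and> (\<forall>I. ideal I R \<longrightarrow> (\<forall>u\<in>tight_closure R 2 I. c \<otimes>\<^bsub>R\<^esub> u \<in> I))"
proof (intro iffI conjI allI impI ballI)
  assume c: "c \<in> \<tau>"
  then show "c \<in> carrier R" by (simp add: test_ideal_def)
  fix I u assume I: "ideal I R" and u: "u \<in> tight_closure R 2 I"
  then have "c \<otimes>\<^bsub>R\<^esub> u [^]\<^bsub>R\<^esub> ((2::nat) ^ 0) \<in> frobenius_power R I (2 ^ 0)"
    using c unfolding test_ideal_def by blast
  moreover have "u \<in> carrier R" using u by (simp add: tight_closure_def)
  ultimately show "c \<otimes>\<^bsub>R\<^esub> u \<in> I" using frobenius_power_1[OF I] by auto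
next
  assume c: "c \<in> carrier R \<and> (\<forall>I. ideal I R \<longrightarrow> (\<forall>u\<in>tight_closure R 2 I. c \<otimes>\<^bsub>R\<^esub> u \<in> I))"
  have "c \<otimes>\<^bsub>R\<^esub> u [^]\<^bsub>R\<^esub> ((2::nat) ^ e) \<in> frobenius_power R I (2 ^ e)"
    if I: "ideal I R" and u: "u \<in> tight_closure R 2 I" for I u e
  proof -
    from u obtain d e0 where d: "u \<in> carrier R" "d \<in> carrier R" "\<forall>P. minimal_prime R P \<longrightarrow> d \<notin> P"
      "\<And>e. e \<ge> e0 \<Longrightarrow> d \<otimes>\<^bsub>R\<^esub> u [^]\<^bsub>R\<^esub> ((2::nat) ^ e) \<in> frobenius_power R I (2 ^ e)"
      unfolding tight_closure_def by blast
    have "d \<otimes>\<^bsub>R\<^esub> (u [^]\<^bsub>R\<^esub> ((2::nat) ^ e)) [^]\<^bsub>R\<^esub> ((2::nat) ^ e')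
        \<in> frobenius_power R (frobenius_power R I (2 ^ e)) (2 ^ e')" if "e' \<ge> e0" for e'
      using d(4)[of "e + e'"] that frobenius_power_mult[OF I, of "2 ^ e" "2 ^ e'"] d(1)
      by (auto simp: R.nat_pow_pow power_add)
    then have "u [^]\<^bsub>R\<^esub> ((2::nat) ^ e) \<in> tight_closure R 2 (frobenius_power R I (2 ^ e))"
      unfolding tight_closure_def using d(1-3) by blast
    then show ?thesis using c ideal_frobenius_power[OF I] by blast
  qed
  then show "c \<in> \<tau>" using c unfolding test_ideal_def by blast
qed

lemma frobenius_power_cartier:
  assumes I: "ideal I R" and \<phi>: "cartier_map e \<phi>" and s: "const s \<noteq> 0"
    and w: "fr w s \<in> frobenius_power R I (2 ^ e)"
  shows "fr (\<phi> w) 1 \<in> I"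
proof -
  let ?J = "{a. fr a 1 \<in> I}"
  have J: "saturated ?J" by (rule saturated_contraction[OF I])
  \<comment> \<open>This is the largest ideal that \<open>\<phi>\<close> maps into the contraction
    of I. Once it is saturated and contains the q-th powers of I, its extension contains the whole
    Frobenius power.\<close>
  define N where "N = {a. \<forall>d. \<phi> (a * d) \<in> ?J}"
  have \<phi>_add: "\<phi> (a + b) = \<phi> a + \<phi> b" and \<phi>_mult: "\<phi> (a ^ (2 ^ e) * b) = a * \<phi> b"
    and \<phi>_f: "f dvd \<phi> (f * a)" for a b
    using \<phi> unfolding cartier_map_def by blast+
  have N: "saturated N"
    unfolding saturated_def
  proof (intro conjI ballI allI impI)
    show "a + b \<in> N" if "a \<in> N" "b \<in> N" for a b
      using that saturated_add[OF J] unfolding N_def by (simp add: distrib_right \<phi>_add)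
    show "r * a \<in> N" if "a \<in> N" for a r
    proof -
      have "\<phi> (a * (r * d)) \<in> ?J" for d using that unfolding N_def by blast
      then show ?thesis unfolding N_def by (simp add: mult_ac)
    qed
    show "a \<in> N" if dvd: "f dvd a" for a
    proof -
      obtain h where h: "a = f * h" using dvd by (elim dvdE)
      have "\<phi> (a * d) \<in> ?J" for d
        using saturated_f[OF J \<phi>_f[of "h * d"]] by (simp add: h mult.assoc)
      then show ?thesis unfolding N_def by blast
    qed
    show "a \<in> N" if sa: "const s \<noteq> 0 \<and> s * a \<in> N" for s a
    proof -
      have "\<phi> (a * d) \<in> ?J" for d
      proof -
        \<comment> \<open>The factor s is completed to s^q, which \<open>\<phi>\<close> releases as
          s; then s cancels in the contraction of I.\<close>
        have "\<phi> ((s * a) * (s ^ (2 ^ e - 1) * d)) \<in> ?J" using sa unfolding N_def by blast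
        moreover have "(s * a) * (s ^ (2 ^ e - 1) * d) = (s ^ (2 ^ e - 1) * s) * (a * d)"
          by (simp only: mult_ac)
        moreover have "s ^ (2 ^ e - 1) * s = s ^ (2 ^ e)"
          by (rule power_minus_mult) simp
        ultimately have "s * \<phi> (a * d) \<in> ?J" by (simp only: \<phi>_mult)
        then show ?thesis by (rule saturated_unit[OF J conjunct1[OF sa]])
      qed
      then show ?thesis unfolding N_def by blast
    qed
  qed
  have "x [^]\<^bsub>R\<^esub> ((2::nat) ^ e) \<in> ext N" if "x \<in> I" for x
  proof -
    from ideal.Icarr[OF I that] obtain a s where x: "x = fr a s" "const s \<noteq> 0" by (rule carrierE)
    then have "a \<in> ?J" using that fr_mem_ideal_iff[OF I x(2)] by simp
    then have "a * \<phi> d \<in> ?J" for d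
      using saturated_mult[OF J, of a "\<phi> d"] by (simp add: mult.commute)
    then have "a ^ (2 ^ e) \<in> N"
      unfolding N_def mem_Collect_eq \<phi>_mult by simp
    then show ?thesis
      using x by (simp add: power_R fr_mem_ext_iff[OF N] const_power)
  qed
  then have "frobenius_power R I (2 ^ e) \<subseteq> ext N"
    unfolding frobenius_power_def by (intro R.genideal_minimal ideal_ext N) blast
  with w have "w \<in> N" using fr_mem_ext_iff[OF N s] by blast
  then have "\<phi> (w * 1) \<in> ?J" unfolding N_def by blast
  then show ?thesis by simp
qed

lemma cartier_mult_mem:
  assumes I: "ideal I R" and \<phi>: "cartier_map e \<phi>" and s: "const s \<noteq> 0" and u: "u \<in> carrier R"
    and w: "fr w s \<otimes>\<^bsub>R\<^esub> u [^]\<^bsub>R\<^esub> ((2::nat) ^ e) \<in> frobenius_power R I (2 ^ e)"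
  shows "fr (\<phi> w) 1 \<otimes>\<^bsub>R\<^esub> u \<in> I"
proof -
  from u obtain v t where v: "u = fr v t" "const t \<noteq> 0" by (rule carrierE)
  then have "fr (v ^ (2 ^ e) * w) (s * t ^ (2 ^ e)) \<in> frobenius_power R I (2 ^ e)"
    using w s by (simp add: power_R mult_R const_power mult.commute)
  then have "fr (\<phi> (v ^ (2 ^ e) * w)) 1 \<in> I"
    using s v(2) by (intro frobenius_power_cartier[OF I \<phi>]) (simp_all add: const_mult const_power)
  moreover have "\<phi> (v ^ (2 ^ e) * w) = v * \<phi> w"
    using \<phi> unfolding cartier_map_def by blast
  ultimately show ?thesis
    using v fr_mem_ideal_iff[OF I v(2)] by (simp add: mult_R mult.commute)
qed

lemma cartier_test_ideal:
  assumes \<phi>: "cartier_map e \<phi>" and w: "fr w 1 \<in> \<tau>"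
  shows "fr (\<phi> w) 1 \<in> \<tau>"
  unfolding test_ideal_iff
proof (intro conjI allI impI ballI)
  fix I u assume I: "ideal I R" and u: "u \<in> tight_closure R 2 I"
  have "fr w 1 \<otimes>\<^bsub>R\<^esub> u [^]\<^bsub>R\<^esub> ((2::nat) ^ e) \<in> frobenius_power R I (2 ^ e)"
    using w I u unfolding test_ideal_def by blast
  then show "fr (\<phi> w) 1 \<otimes>\<^bsub>R\<^esub> u \<in> I"
    using u by (intro cartier_mult_mem[OF I \<phi>, of 1]) (simp_all add: tight_closure_def)
qed simp

text \<open>In a domain, avoiding the minimal primes amounts to being nonzero; this direction turns
  the multiplier of a tight closure into a polynomial not divisible by f.\<close>

lemma minimal_prime_zero: "minimal_prime R {\<zero>\<^bsub>R\<^esub>}"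
  unfolding minimal_prime_def
proof (intro conjI allI impI)
  show "primeideal {\<zero>\<^bsub>R\<^esub>} R" by (rule R.zeroprimeideal)
  fix Q assume Q: "primeideal Q R \<and> Q \<subseteq> {\<zero>\<^bsub>R\<^esub>}"
  then have "ideal Q R" unfolding primeideal_def by blast
  then have "\<zero>\<^bsub>R\<^esub> \<in> Q" by (intro additive_subgroup.zero_closed ideal.axioms(1))
  with Q show "Q = {\<zero>\<^bsub>R\<^esub>}" by blast
qed

text \<open>The multiplier depends on u and I, and so do e and the Cartier map chosen for it; the
  image z^4 does not. This uniformity is what the test ideal demands.\<close>

lemma poly_var_power4_test_ideal: "fr (poly_var z ^ 4) 1 \<in> \<tau>"
  unfolding test_ideal_iff
proof (intro conjI allI impI ballI)
  fix I u assume I: "ideal I R" and u: "u \<in> tight_closure R 2 I"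
  from u obtain c e0 where c: "u \<in> carrier R" "c \<in> carrier R" "\<forall>P. minimal_prime R P \<longrightarrow> c \<notin> P"
    "\<And>e. e \<ge> e0 \<Longrightarrow> c \<otimes>\<^bsub>R\<^esub> u [^]\<^bsub>R\<^esub> ((2::nat) ^ e) \<in> frobenius_power R I (2 ^ e)"
    unfolding tight_closure_def by blast
  from c(2) obtain c' s where c': "c = fr c' s" "const s \<noteq> 0" by (rule carrierE)
  have "c \<noteq> \<zero>\<^bsub>R\<^esub>" using c(3) minimal_prime_zero by blast
  then have "\<not> f dvd c'" using c' by (simp add: zero_R fr_eq_iff)
  then obtain q h where qh: "q * c' + h * f \<noteq> 0" "free_of z (q * c' + h * f)"
    using exists_free_of_multiple[OF char] by blast
  let ?b = "q * c' + h * f"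
  obtain e1 where e1: "\<And>e. e \<ge> e1 \<Longrightarrow> \<exists>\<phi>. cartier_map e \<phi> \<and> \<phi> ?b = poly_var z ^ 4"
    using exists_cartier_map_free_of[OF char qh] by blast
  \<comment> \<open>One exponent is enough, provided that it is large both for the tight closure
    condition and for the existence of the Cartier map.\<close>
  define e where "e = max e0 e1"
  obtain \<phi> where \<phi>: "cartier_map e \<phi>" "\<phi> ?b = poly_var z ^ 4"
    using e1[of e] unfolding e_def by auto
  have b: "fr ?b s = fr q 1 \<otimes>\<^bsub>R\<^esub> c"
    using c' by (simp add: mult_R fr_eq_iff algebra_simps)
  have "fr q 1 \<otimes>\<^bsub>R\<^esub> (c \<otimes>\<^bsub>R\<^esub> u [^]\<^bsub>R\<^esub> ((2::nat) ^ e)) \<in> frobenius_power R I (2 ^ e)"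
    by (rule ideal.I_l_closed[OF ideal_frobenius_power[OF I]]) (simp_all add: c(4) e_def)
  then have "fr ?b s \<otimes>\<^bsub>R\<^esub> u [^]\<^bsub>R\<^esub> ((2::nat) ^ e) \<in> frobenius_power R I (2 ^ e)"
    unfolding b using c(1,2) by (simp add: R.m_assoc)
  from cartier_mult_mem[OF I \<phi>(1) c'(2) c(1) this]
  show "fr (poly_var z ^ 4) 1 \<otimes>\<^bsub>R\<^esub> u \<in> I" unfolding \<phi>(2) .
qed simp

lemma halve_test_ideal:
  assumes "fr (single m 1) 1 \<in> \<tau>"
  shows "fr (single (halve (single k 5 + m)) 1) 1 \<in> \<tau>"
proof -
  obtain \<phi> :: "'k poly5 \<Rightarrow> 'k poly5"
    where "cartier_map 1 \<phi>" "\<phi> (single m 1) = single (halve (single k 5 + m)) 1"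
    using exists_cartier_map_halve[OF char] by blast
  then show ?thesis using cartier_test_ideal assms by metis
qed

lemma exists_two_others:
  obtains j k where "j \<noteq> k" "j \<noteq> l" "k \<noteq> (l::5)"
proof (cases "l = 1")
  case True
  then show ?thesis using that[of 2 3] by simp
next
  case False
  then show ?thesis
    by (cases "l = 2") (use that[of 1 3] that[of 1 2] in auto)
qed

text \<open>The indices may coincide: i = l gives x_l^3. In each step the added exponent 5 is odd
  and is rounded down to 2, also on top of an even exponent.\<close>

lemma monomial_test_ideal: "fr (single (single i 1 + single l 2) 1) 1 \<in> \<tau>"
proof -
  have halve_eqI: "halve m = n" if "\<And>i. lookup m i div 2 = lookup n i" for m n
    using that by (intro poly_mapping_eqI) simp
  have 1: "fr (single (single j 4) 1) 1 \<in> \<tau>" for j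
    using poly_var_power4_test_ideal[of j] by (simp add: poly_var_power)
  have 2: "fr (single (single j 2 + single k 2) 1) 1 \<in> \<tau>" for j k
  proof -
    have "halve (single k 5 + single j 4) = single j 2 + single k 2"
      by (rule halve_eqI) (simp add: lookup_add lookup_single when_def)
    then show ?thesis using halve_test_ideal[OF 1, of k j] by simp
  qed
  have 3: "fr (single (single i 2 + single j 1 + single k 1) 1) 1 \<in> \<tau>" for i j k
  proof -
    have "halve (single i 5 + (single j 2 + single k 2)) = single i 2 + single j 1 + single k 1"
      by (rule halve_eqI) (simp add: lookup_add lookup_single when_def)
    then show ?thesis using halve_test_ideal[OF 2, of i j k] by simp
  qed
  \<comment> \<open>Halving x_l^5 x_i^2 x_j x_k must make the single factors x_j and x_k disappear.
    That happens because they are distinct from each other and from x_l, even if i is one of j, k,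
    l.\<close>
  obtain j k where jk: "j \<noteq> k" "j \<noteq> l" "k \<noteq> l" by (rule exists_two_others)
  have "halve (single l 5 + (single i 2 + single j 1 + single k 1)) = single i 1 + single l 2"
    by (rule halve_eqI) (use jk in \<open>auto simp: lookup_add lookup_single when_def\<close>)
  then show ?thesis using halve_test_ideal[OF 3, of l i j k] by simp
qed


text \<open>Write s as its constant term plus n. Frobenius is additive, so n^q is a combination of
  q-th powers of nonconstant monomials and lies in N. Modulo N, s^q thus acts as a nonzero constant
  and s can be cancelled.\<close>

lemma saturatedI:
  assumes add: "\<And>a b. a \<in> N \<Longrightarrow> b \<in> N \<Longrightarrow> a + b \<in> N"
    and mult: "\<And>a r. a \<in> N \<Longrightarrow> r * a \<in> N" and f: "f \<in> N"
    and monomial: "\<And>m. m \<noteq> 0 \<Longrightarrow> single (stretch (2 ^ e) m) 1 \<in> N"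
  shows "saturated N"
proof -
  let ?q = "2 ^ e :: nat"
  have zero: "0 \<in> N" using mult[OF f, of 0] by simp
  have sum: "(\<Sum>i\<in>A. g i) \<in> N" if "\<And>i. i \<in> A \<Longrightarrow> g i \<in> N" for A :: "(5 \<Rightarrow>\<^sub>0 nat) set" and g
    using that by (induction A rule: infinite_finite_induct) (simp_all add: zero add)
  have unit: "a \<in> N" if s: "const s \<noteq> 0" and sa: "s * a \<in> N" for s a
  proof -
    define n where "n = s - single 0 (const s)"
    have s_eq: "s = single 0 (const s) + n" by (simp add: n_def)
    have "const n = 0" by (simp add: n_def lookup_minus)
    have single: "single m c ^ ?q \<in> N" if "m \<noteq> 0" for m and c :: 'k
    proof -
      have "single 0 (c ^ ?q) * single (stretch ?q m) 1 \<in> N" by (intro mult monomial that)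
      then show ?thesis by (simp add: power_single mult_single)
    qed
    have "m \<noteq> 0" if "m \<in> keys n" for m
      using that \<open>const n = 0\<close> by (auto simp: in_keys_iff)
    then have "(\<Sum>m\<in>keys n. single m (lookup n m) ^ ?q) \<in> N"
      by (intro sum single)
    then have nq: "n ^ ?q \<in> N"
      by (subst poly_mapping_sum_singles[of n]) (simp only: char2_power_sum[OF char2])
    have "stretch ?q 0 = 0" by (rule poly_mapping_eqI) simp
    then have sq: "s ^ ?q = single 0 (const s ^ ?q) + n ^ ?q"
      by (subst s_eq) (simp only: char2_power_add[OF char2] power_single)
    have "s ^ ?q = s ^ (?q - 1) * s" by (rule power_minus_mult[symmetric]) simp
    then have "s ^ ?q * a = s ^ (?q - 1) * (s * a)" by (simp only: mult.assoc)
    then have sqa: "s ^ ?q * a \<in> N" by (simp only: mult[OF sa])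
    have "a = single 0 (inverse (const s ^ ?q)) * (single 0 (const s ^ ?q) * a)"
      using s by (simp add: mult_single flip: mult.assoc)
    also have "single 0 (const s ^ ?q) * a = s ^ ?q * a + (- a) * n ^ ?q"
      by (simp add: sq algebra_simps)
    finally show "a \<in> N" using mult add sqa nq by metis
  qed
  have dvd: "a \<in> N" if "f dvd a" for a
    using that mult[OF f] by (elim dvdE) (simp add: mult.commute)
  show ?thesis
    unfolding saturated_def
    by (intro conjI ballI allI impI; (elim conjE)?) (erule (1) add, erule mult, erule dvd, erule (1) unit)
qed


section \<open>The test ideal consists of elements of order at least three\<close>

text \<open>This is the ideal (x_1^5, ..., x_5^5), described by its monomials. It already contains
  f, so membership in the local ring is still decided monomial by monomial.\<close>

definition fifth_powers :: "'k poly5 set" where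
  "fifth_powers = {a. \<forall>m\<in>keys a. \<exists>i. 5 \<le> lookup m i}"

lemma saturated_fifth_powers: "saturated fifth_powers"
\<comment> \<open>The exponent 2^3 = 8 is the first power of two that reaches 5.\<close>
proof (rule saturatedI[where e = 3])
  show "a + b \<in> fifth_powers" if "a \<in> fifth_powers" "b \<in> fifth_powers" for a b
    using that unfolding fifth_powers_def by (blast elim: keys_addE)
  show "r * a \<in> fifth_powers" if a: "a \<in> fifth_powers" for a r
  proof -
    have "\<exists>i. 5 \<le> lookup m i" if "m \<in> keys (r * a)" for m
    proof -
      from that obtain m1 m2 where m: "m1 \<in> keys r" "m2 \<in> keys a" "m = m1 + m2" by (rule keys_multE)
      from a m(2) obtain i where "5 \<le> lookup m2 i" unfolding fifth_powers_def by blast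
      then show ?thesis unfolding m(3) by (intro exI[of _ i]) (simp add: lookup_add)
    qed
    then show ?thesis unfolding fifth_powers_def by blast
  qed
  have "\<exists>i. 5 \<le> lookup m i" if "m \<in> keys f" for m
  proof -
    from that obtain i where "m \<in> keys (single (single i 5) (1::'k))"
      unfolding fermat_quintic_eq by (rule keys_sumE)
    then show ?thesis by (intro exI[of _ i]) simp
  qed
  then show "f \<in> fifth_powers" unfolding fifth_powers_def by blast
  show "single (stretch (2 ^ 3) m) 1 \<in> fifth_powers" if "m \<noteq> 0" for m
  proof -
    from that obtain i where "lookup m i \<noteq> 0" by (metis lookup_zero poly_mapping_eqI)
    then have "5 \<le> lookup (stretch (2 ^ 3) m) i" by simp
    then show ?thesis unfolding fifth_powers_def by (simp del: lookup_stretch) blast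
  qed
qed

text \<open>The hypothesis puts u^4 into I^[4] modulo f. Applying Frobenius repeatedly extends this
  to all q \<ge> 4, so the multiplier 1 works.\<close>

lemma tight_closure_fifth_powersI:
  assumes "u ^ 4 = v * ((poly_var i ^ 5) ^ 4 * g1 + (poly_var j ^ 5) ^ 4 * g2 + (poly_var k ^ 5) ^ 4 * g3
      + (poly_var l ^ 5) ^ 4 * g4 + f * h)"
  shows "fr u 1 \<in> tight_closure R 2 (ext fifth_powers)"
proof -
  have u: "u ^ 4 = (v * g1) * poly_var i ^ 20 + (v * g2) * poly_var j ^ 20 + (v * g3) * poly_var k ^ 20
      + (v * g4) * poly_var l ^ 20 + f * (v * h)"
    unfolding assms by (simp add: distrib_left mult_ac flip: power_mult)
  have I: "ideal (ext fifth_powers) R" by (rule ideal_ext[OF saturated_fifth_powers])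
  have "\<one>\<^bsub>R\<^esub> \<otimes>\<^bsub>R\<^esub> fr u 1 [^]\<^bsub>R\<^esub> ((2::nat) ^ e) \<in> frobenius_power R (ext fifth_powers) (2 ^ e)"
    if "e \<ge> 2" for e
  proof -
    let ?J = "{a. fr a 1 \<in> frobenius_power R (ext fifth_powers) (2 ^ e)}"
    have J: "saturated ?J"
      by (rule saturated_contraction[OF ideal_frobenius_power[OF I]])
    define q :: nat where "q = 2 ^ (e - 2)"
    have "(2::nat) ^ e = 2\<^sup>2 * 2 ^ (e - 2)"
      using that by (simp only: power_add[symmetric] le_add_diff_inverse)
    then have q: "2 ^ e = 4 * q" by (simp add: q_def)
    have summand: "g ^ q * (poly_var i ^ 20) ^ q \<in> ?J" for g i
    proof -
      have "poly_var i ^ 5 \<in> fifth_powers"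
        by (simp add: fifth_powers_def poly_var_power) (metis lookup_single_eq order_refl)
      then have "fr (poly_var i ^ 5) 1 \<in> ext fifth_powers"
        by (simp add: fr_mem_ext_iff[OF saturated_fifth_powers])
      then have "fr (poly_var i ^ 5) 1 [^]\<^bsub>R\<^esub> ((2::nat) ^ e) \<in> frobenius_power R (ext fifth_powers) (2 ^ e)"
        by (rule power_mem_frobenius_power[OF I])
      moreover have "fr (poly_var i ^ 5) 1 [^]\<^bsub>R\<^esub> ((2::nat) ^ e) = fr ((poly_var i ^ 20) ^ q) 1"
        by (simp add: power_R q mult.commute flip: power_mult)
      ultimately show ?thesis by (intro saturated_mult[OF J]) simp
    qed
    have "u ^ (2 ^ e) = (u ^ 4) ^ q"
      unfolding q by (rule power_mult)
    also have "\<dots> = (v * g1) ^ q * (poly_var i ^ 20) ^ q + (v * g2) ^ q * (poly_var j ^ 20) ^ q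
        + (v * g3) ^ q * (poly_var k ^ 20) ^ q + (v * g4) ^ q * (poly_var l ^ 20) ^ q + f ^ q * (v * h) ^ q"
      unfolding u q_def char2_power_add[OF char2] power_mult_distrib ..
    also have "\<dots> \<in> ?J"
      by (intro saturated_add[OF J] summand saturated_f[OF J] dvd_mult2) (simp add: q_def dvd_power)
    finally show ?thesis by (simp add: power_R)
  qed
  moreover have "\<forall>P. minimal_prime R P \<longrightarrow> \<one>\<^bsub>R\<^esub> \<notin> P"
  proof (intro allI impI notI)
    fix P assume "minimal_prime R P" "\<one>\<^bsub>R\<^esub> \<in> P"
    then have P: "primeideal P R" by (simp add: minimal_prime_def)
    then have "P = carrier R" using \<open>\<one>\<^bsub>R\<^esub> \<in> P\<close> ideal.one_imp_carrier primeideal_def by blast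
    then show False using primeideal.I_notcarr[OF P] by simp
  qed
  ultimately show ?thesis
    unfolding tight_closure_def by fastforce
qed

text \<open>With \<open>a, \<dots>, e\<close> the fifth powers of the variables, the next two identities show that \<open>u\<^sup>4 \<in> I\<^sup>[\<^sup>4\<^sup>]\<close> for
  \<open>I = (x\<^sub>1\<^sup>5, \<dots>, x\<^sub>5\<^sup>5)\<close> and the two kinds of monomials \<open>u = x\<^sup>4\<^sup>-\<^sup>m\<close> where \<open>m\<close> is maximal among the exponents outside
  \<open>(x\<^sub>i x\<^sub>j\<^sup>2)\<close>: after elimination of \<open>e\<close>, every monomial in \<open>a, b, c, d\<close> has an exponent at least 4.\<close>

lemma char2_square_identity:
  fixes a b c d e f' :: "'k poly5"
  assumes "f' = a + b + c + d + e"
  shows "(a * b * c * d * e)\<^sup>2 = a ^ 4 * (b\<^sup>2 * c\<^sup>2 * d\<^sup>2) + b ^ 4 * (a\<^sup>2 * c\<^sup>2 * d\<^sup>2)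
    + c ^ 4 * (a\<^sup>2 * b\<^sup>2 * d\<^sup>2) + d ^ 4 * (a\<^sup>2 * b\<^sup>2 * c\<^sup>2) + f' * (f' * a\<^sup>2 * b\<^sup>2 * c\<^sup>2 * d\<^sup>2)"
proof -
  have "e = f' - (a + b + c + d)" by (simp add: assms)
  then have "e = f' + a + b + c + d" by (simp add: char2_minus[OF char2] add.assoc)
  then have e2: "e\<^sup>2 = f'\<^sup>2 + a\<^sup>2 + b\<^sup>2 + c\<^sup>2 + d\<^sup>2"
    using char2_power_add[OF char2, where e = 1] by simp
  have "(a * b * c * d * e)\<^sup>2 = a\<^sup>2 * b\<^sup>2 * c\<^sup>2 * d\<^sup>2 * e\<^sup>2" by (simp add: power_mult_distrib)
  then show ?thesis unfolding e2 by (simp add: algebra_simps power2_eq_square eval_nat_numeral)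
qed

lemma char2_cube_identity:
  fixes a b c d e f' :: "'k poly5"
  assumes "f' = a + b + c + d + e" and s: "s = a\<^sup>2 + b\<^sup>2 + c\<^sup>2 + d\<^sup>2"
  shows "a * (b * c * d * e) ^ 3 = a ^ 4 * (b ^ 3 * c ^ 3 * d ^ 3)
    + b ^ 4 * (a\<^sup>2 * b * c ^ 3 * d ^ 3 + a * c ^ 3 * d ^ 3 * s)
    + c ^ 4 * (a\<^sup>2 * b ^ 3 * c * d ^ 3 + a * b ^ 3 * d ^ 3 * s)
    + d ^ 4 * (a\<^sup>2 * b ^ 3 * c ^ 3 * d + a * b ^ 3 * c ^ 3 * s)
    + f' * ((a * b ^ 3 * c ^ 3 * d ^ 3) * (f'\<^sup>2 + s + f' * (a + b + c + d)))"
proof -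
  have "e = f' - (a + b + c + d)" by (simp add: assms)
  then have e: "e = f' + a + b + c + d" by (simp add: char2_minus[OF char2] add.assoc)
  then have "e\<^sup>2 = f'\<^sup>2 + s"
    using char2_power_add[OF char2, where e = 1] by (simp add: s)
  then have "e ^ 3 = (f' + a + b + c + d) * (f'\<^sup>2 + s)"
    by (metis e power2_eq_square power3_eq_cube mult.assoc)
  then have "a * (b * c * d * e) ^ 3 = a * b ^ 3 * c ^ 3 * d ^ 3 * ((f' + a + b + c + d) * (f'\<^sup>2 + s))"
    by (simp add: power_mult_distrib)
  also have "\<dots> = a * b ^ 3 * c ^ 3 * d ^ 3 * (a * s) + a * b ^ 3 * c ^ 3 * d ^ 3 * ((b + c + d) * s)
      + f' * ((a * b ^ 3 * c ^ 3 * d ^ 3) * (f'\<^sup>2 + s + f' * (a + b + c + d)))"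
    by (simp add: algebra_simps power2_eq_square)
  also have "a * b ^ 3 * c ^ 3 * d ^ 3 * (a * s) = a ^ 4 * (b ^ 3 * c ^ 3 * d ^ 3)
      + b ^ 4 * (a\<^sup>2 * b * c ^ 3 * d ^ 3) + c ^ 4 * (a\<^sup>2 * b ^ 3 * c * d ^ 3) + d ^ 4 * (a\<^sup>2 * b ^ 3 * c ^ 3 * d)"
    unfolding s by (simp add: algebra_simps power2_eq_square eval_nat_numeral)
  also have "a * b ^ 3 * c ^ 3 * d ^ 3 * ((b + c + d) * s) = b ^ 4 * (a * c ^ 3 * d ^ 3 * s)
      + c ^ 4 * (a * b ^ 3 * d ^ 3 * s) + d ^ 4 * (a * b ^ 3 * c ^ 3 * s)"
    by (simp add: algebra_simps eval_nat_numeral)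
  finally show ?thesis by (simp add: algebra_simps)
qed

definition constant_exponent :: "nat \<Rightarrow> (5 \<Rightarrow>\<^sub>0 nat)" where
  "constant_exponent n = (\<Sum>i\<in>UNIV. single i n)"

lemma lookup_constant_exponent [simp]: "lookup (constant_exponent n) i = n"
  by (simp add: constant_exponent_def lookup_sum lookup_single when_def)

lemma exists_enumeration_5:
  obtains j k l n where "distinct [i, j, k, l, n]" "(UNIV :: 5 set) = {i, j, k, l, n}"
proof -
  have "finite (UNIV - {i})" by simp
  then obtain xs where xs: "set xs = UNIV - {i}" "distinct xs"
    using finite_distinct_list by blast
  then have "length xs = 4" using distinct_card[OF xs(2)] by (simp add: card_Diff_singleton)
  then obtain j k l n where "xs = [j, k, l, n]"
    by (auto simp: eval_nat_numeral length_Suc_conv)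
  with xs show ?thesis by (intro that[of j k l n]) auto
qed

lemma cubes_tight_closure:
  "fr (single (constant_exponent 3) 1) 1 \<in> tight_closure R 2 (ext fifth_powers)"
proof -
  let ?x = "poly_var :: 5 \<Rightarrow> 'k poly5"
  let ?u = "single (constant_exponent 3) (1::'k)"
  have u: "?u = ?x 1 ^ 3 * ?x 2 ^ 3 * ?x 3 ^ 3 * ?x 4 ^ 3 * ?x 5 ^ 3"
    unfolding prod_poly_var[symmetric] UNIV_5 by (simp add: mult.assoc)
  have "f = ?x 1 ^ 5 + ?x 2 ^ 5 + ?x 3 ^ 5 + ?x 4 ^ 5 + ?x 5 ^ 5"
    by (simp add: fermat_quintic_def sum_5)
  note id = char2_square_identity[OF this]
  \<comment> \<open>Every variable has exponent 12 = 2 + 2*5, which exposes the square of the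
    product of the fifth powers.\<close>
  have "?u ^ 4 = (?x 1 * ?x 2 * ?x 3 * ?x 4 * ?x 5)\<^sup>2 * (?x 1 ^ 5 * ?x 2 ^ 5 * ?x 3 ^ 5 * ?x 4 ^ 5 * ?x 5 ^ 5)\<^sup>2"
    unfolding u power_mult_distrib by (simp add: mult_ac flip: power_mult power_add)
  from tight_closure_fifth_powersI[OF this[unfolded id]] show ?thesis .
qed

lemma fourth_powers_tight_closure:
  "fr (single (constant_exponent 4 - single i 2) 1) 1 \<in> tight_closure R 2 (ext fifth_powers)"
proof -
  let ?x = "poly_var :: 5 \<Rightarrow> 'k poly5"
  let ?u = "single (constant_exponent 4 - single i 2) (1::'k)"
  obtain j k l n where *: "distinct [i, j, k, l, n]" "(UNIV :: 5 set) = {i, j, k, l, n}"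
    by (rule exists_enumeration_5)
  have u: "?u = ?x i ^ 2 * ?x j ^ 4 * ?x k ^ 4 * ?x l ^ 4 * ?x n ^ 4"
    using *(1) unfolding prod_poly_var[symmetric] *(2)
    by (simp add: lookup_minus lookup_single mult.assoc)
  have "f = ?x i ^ 5 + ?x j ^ 5 + ?x k ^ 5 + ?x l ^ 5 + ?x n ^ 5"
    using *(1) unfolding fermat_quintic_def *(2) by (simp add: add.assoc)
  note id = char2_cube_identity[OF this refl]
  \<comment> \<open>The exponent of x_i is 8 = 3 + 5 and the others are 16 = 1 + 3*5, matching the
    cube identity.\<close>
  have "?u ^ 4 = (?x i ^ 3 * ?x j * ?x k * ?x l * ?x n) * (?x i ^ 5 * (?x j ^ 5 * ?x k ^ 5 * ?x l ^ 5 * ?x n ^ 5) ^ 3)"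
    unfolding u power_mult_distrib by (simp add: eval_nat_numeral mult_ac)
  from tight_closure_fifth_powersI[OF this[unfolded id]] show ?thesis .
qed

text \<open>Multiplying by a monomial shifts exponents without cancellation, and the target ideal is
  monomial; so the condition holds for each monomial of the numerator separately.\<close>

lemma test_ideal_monomial_colon:
  assumes c: "fr a s \<in> \<tau>" "const s \<noteq> 0" and m: "m \<in> keys a"
    and u: "fr (single u 1) 1 \<in> tight_closure R 2 (ext fifth_powers)"
  shows "\<exists>i. 5 \<le> lookup m i + lookup u i"
proof -
  have "fr a s \<otimes>\<^bsub>R\<^esub> fr (single u 1) 1 \<in> ext fifth_powers"
    using c(1) u ideal_ext[OF saturated_fifth_powers] unfolding test_ideal_iff by blast
  then have "single u 1 * a \<in> fifth_powers"
    using c(2) by (simp add: mult_R fr_mem_ext_iff[OF saturated_fifth_powers] mult.commute)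
  moreover have "u + m \<in> keys (single u 1 * a)"
    using m by (simp add: in_keys_iff lookup_single_mult lookup_add)
  ultimately have "\<exists>i. 5 \<le> lookup (u + m) i" unfolding fifth_powers_def by blast
  then show ?thesis by (simp add: lookup_add add.commute)
qed

lemma test_ideal_keys:
  assumes "fr a s \<in> \<tau>" "const s \<noteq> 0" "m \<in> keys a"
  obtains i where "2 \<le> lookup m i" and "3 \<le> lookup m i \<or> (\<exists>j. j \<noteq> i \<and> 1 \<le> lookup m j)"
proof -
  obtain i where i: "2 \<le> lookup m i"
    using test_ideal_monomial_colon[OF assms cubes_tight_closure] by fastforce
  \<comment> \<open>The multiplier is chosen for the i just found. It has exponent 2 at i and 4
    elsewhere, so m needs either 3 at i or 1 at another variable.\<close>
  obtain j where "5 \<le> lookup m j + lookup (constant_exponent 4 - single i 2) j"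
    using test_ideal_monomial_colon[OF assms fourth_powers_tight_closure] by blast
  then have "3 \<le> lookup m i \<or> (j \<noteq> i \<and> 1 \<le> lookup m j)"
    by (cases "j = i") (simp_all add: lookup_minus lookup_single)
  with i that show ?thesis by blast
qed


section \<open>The order filtration\<close>

definition deg :: "(5 \<Rightarrow>\<^sub>0 nat) \<Rightarrow> nat" where
  "deg m = (\<Sum>i\<in>UNIV. lookup m i)"

lemma deg_add: "deg (m + n) = deg m + deg n"
  by (simp add: deg_def lookup_add sum.distrib)

lemma deg_single [simp]: "deg (single i n) = n"
  by (simp add: deg_def lookup_single when_def)

lemma lookup_le_deg: "lookup m i \<le> deg m"
  unfolding deg_def by (rule member_le_sum) simp_all

lemma deg_stretch: "deg (stretch n m) = n * deg m"
  by (simp add: deg_def sum_distrib_left)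

lemma deg_SucE:
  assumes "Suc n \<le> deg m"
  obtains i m' where "m = single i 1 + m'" "n \<le> deg m'"
proof -
  from assms obtain i where i: "lookup m i \<noteq> 0"
    unfolding deg_def by (metis (no_types, lifting) Suc_n_not_le_n le_0_eq old.nat.distinct(1) sum.neutral)
  have m: "m = single i 1 + (m - single i 1)"
  proof (rule poly_mapping_eqI)
    show "lookup m j = lookup (single i 1 + (m - single i 1)) j" for j
      using i by (cases "j = i") (simp_all add: lookup_add lookup_minus lookup_single)
  qed
  from arg_cong[OF this, of deg] have "deg m = 1 + deg (m - single i 1)"
    by (simp only: deg_add deg_single)
  with assms show ?thesis by (intro that[OF m]) simp
qed

text \<open>Order at least k, measured on the best representative modulo f. The correction by h is
  needed to make f a member once k exceeds 5.\<close>

definition filt :: "nat \<Rightarrow> 'k poly5 set" where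
  "filt k = {a. \<exists>h. \<forall>m\<in>keys (a + f * h). k \<le> deg m}"

lemma filtI: "(\<And>m. m \<in> keys a \<Longrightarrow> k \<le> deg m) \<Longrightarrow> a \<in> filt k"
  unfolding filt_def by (intro CollectI exI[of _ 0]) simp

lemma keys_f_deg: "m \<in> keys f \<Longrightarrow> deg m = 5"
  unfolding fermat_quintic_eq by (elim keys_sumE) simp

text \<open>All monomials of f have degree 5, so changing the representative cannot affect the
  orders up to 5.\<close>

lemma filtD:
  assumes a: "a \<in> filt k" and k: "k \<le> 5" and m: "m \<in> keys a"
  shows "k \<le> deg m"
proof -
  from a obtain h where h: "\<And>m. m \<in> keys (a + f * h) \<Longrightarrow> k \<le> deg m"
    unfolding filt_def by blast
  have "a = (a + f * h) + f * (- h)" by (simp add: algebra_simps)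
  with m have "m \<in> keys ((a + f * h) + f * (- h))" by metis
  then show ?thesis
  proof (cases rule: keys_addE)
    case 2
    then obtain m1 m2 where "m1 \<in> keys f" "m = m1 + m2" by (rule keys_multE)
    then show ?thesis using k keys_f_deg[of m1] by (simp add: deg_add)
  qed (rule h)
qed

lemma filt_mult:
  assumes a: "a \<in> filt i" and b: "b \<in> filt j"
  shows "a * b \<in> filt (i + j)"
proof -
  from a obtain h where h: "\<And>m. m \<in> keys (a + f * h) \<Longrightarrow> i \<le> deg m" unfolding filt_def by blast
  from b obtain h' where h': "\<And>m. m \<in> keys (b + f * h') \<Longrightarrow> j \<le> deg m" unfolding filt_def by blast
  have "a * b + f * (h * b + a * h' + f * h * h') = (a + f * h) * (b + f * h')"
    by (simp add: algebra_simps)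
  moreover have "i + j \<le> deg m" if "m \<in> keys ((a + f * h) * (b + f * h'))" for m
  proof -
    from that obtain m1 m2 where "m1 \<in> keys (a + f * h)" "m2 \<in> keys (b + f * h')" "m = m1 + m2"
      by (rule keys_multE)
    then show ?thesis using h[of m1] h'[of m2] by (simp add: deg_add)
  qed
  ultimately have "\<forall>m\<in>keys (a * b + f * (h * b + a * h' + f * h * h')). i + j \<le> deg m" by metis
  then show ?thesis unfolding filt_def by blast
qed

lemma filt_antimono: "i \<le> j \<Longrightarrow> filt j \<subseteq> filt i"
  unfolding filt_def by (intro Collect_mono impI, elim exE) (rule exI, rule ballI, erule order.trans, erule (1) bspec)

lemma saturated_filt: "saturated (filt k)"
\<comment> \<open>Since 2^k > k, the 2^k-th power of a nonconstant monomial has degree at least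
  k.\<close>
proof (rule saturatedI[where e = k])
  show "a + b \<in> filt k" if a: "a \<in> filt k" and b: "b \<in> filt k" for a b
  proof -
    from a obtain h where h: "\<And>m. m \<in> keys (a + f * h) \<Longrightarrow> k \<le> deg m" unfolding filt_def by blast
    from b obtain h' where h': "\<And>m. m \<in> keys (b + f * h') \<Longrightarrow> k \<le> deg m" unfolding filt_def by blast
    have "a + b + f * (h + h') = (a + f * h) + (b + f * h')" by (simp add: algebra_simps)
    moreover have "k \<le> deg m" if "m \<in> keys ((a + f * h) + (b + f * h'))" for m
      using that by (rule keys_addE) (erule h, erule h')
    ultimately have "\<forall>m\<in>keys (a + b + f * (h + h')). k \<le> deg m" by metis
    then show ?thesis unfolding filt_def by blast
  qed
  show "r * a \<in> filt k" if "a \<in> filt k" for a r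
    using filt_mult[OF filtI[of r 0] that] by simp
  show "f \<in> filt k" unfolding filt_def by (intro CollectI exI[of _ "- 1"]) simp
  show "single (stretch (2 ^ k) m) 1 \<in> filt k" if "m \<noteq> 0" for m
  proof (rule filtI)
    fix m' assume "m' \<in> keys (single (stretch (2 ^ k) m) (1::'k))"
    then have "deg m' = 2 ^ k * deg m" by (simp add: deg_stretch)
    moreover have "deg m \<noteq> 0"
    proof
      assume "deg m = 0"
      then have "lookup m i = 0" for i using lookup_le_deg[of m i] by simp
      then have "m = 0" by (intro poly_mapping_eqI) simp
      with that show False ..
    qed
    moreover have "k < 2 ^ k" by (rule less_exp)
    ultimately show "k \<le> deg m'" by (simp add: trans_le_add1 order.trans[of k "2 ^ k"])
  qed
qed

lemma ext_mono: "N \<subseteq> N' \<Longrightarrow> ext N \<subseteq> ext N'"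
  unfolding ext_def by blast

lemma ext_filt_mult:
  assumes x: "x \<in> ext (filt i)" and y: "y \<in> ext (filt j)"
  shows "x \<otimes>\<^bsub>R\<^esub> y \<in> ext (filt (i + j))"
proof -
  from x obtain a s where a: "x = fr a s" "a \<in> filt i" "const s \<noteq> 0" unfolding ext_def by blast
  from y obtain b t where b: "y = fr b t" "b \<in> filt j" "const t \<noteq> 0" unfolding ext_def by blast
  show ?thesis
    using a b filt_mult[OF a(2) b(2)] by (simp add: mult_R fr_mem_ext_iff[OF saturated_filt] const_mult)
qed

lemma carrier_eq_ext_filt_0: "carrier R = ext (filt 0)"
proof -
  have "filt 0 = UNIV" by (auto intro: filtI)
  then show ?thesis unfolding carrier_R ext_def by simp
qed

lemma ext_filt_power: "x \<in> ext (filt d) \<Longrightarrow> x [^]\<^bsub>R\<^esub> (n::nat) \<in> ext (filt (d * n))"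
proof (induction n)
  case 0
  then show ?case using carrier_eq_ext_filt_0 by auto
next
  case (Suc n)
  then show ?case using ext_filt_mult[of "x [^]\<^bsub>R\<^esub> n" "d * n" x d] by (simp add: add.commute)
qed

lemma ideal_prod_subset_ext_filt:
  assumes "A \<subseteq> ext (filt i)" "B \<subseteq> ext (filt j)"
  shows "ideal_prod R A B \<subseteq> ext (filt (i + j))"
proof
  fix x assume "x \<in> ideal_prod R A B"
  then show "x \<in> ext (filt (i + j))"
  proof (induction rule: ideal_prod.induct)
    case (prod a b)
    then show ?case using assms by (intro ext_filt_mult) blast+
  next
    case (sum x y)
    then show ?case
      using ideal_ext[OF saturated_filt] by (intro additive_subgroup.a_closed ideal.axioms(1))
  qed
qed

lemma ideal_power_subset_ext_filt:
  assumes "A \<subseteq> ext (filt k)"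
  shows "ideal_power R A n \<subseteq> ext (filt (k * n))"
proof (induction n)
  case 0
  then show ?case using carrier_eq_ext_filt_0 by simp
next
  case (Suc n)
  then show ?case using ideal_prod_subset_ext_filt[OF assms Suc.IH] by simp
qed

lemma fr_sum_closed:
  assumes s: "const s \<noteq> 0" and add: "\<And>x y. x \<in> T \<Longrightarrow> y \<in> T \<Longrightarrow> x \<oplus>\<^bsub>R\<^esub> y \<in> T"
    and zero: "fr 0 s \<in> T" and g: "\<And>i. i \<in> A \<Longrightarrow> fr (g i) s \<in> T"
  shows "fr (\<Sum>i\<in>A. g i) s \<in> T"
  using g
proof (induction A rule: infinite_finite_induct)
  case (insert i A)
  have "fr (g i + (\<Sum>i\<in>A. g i)) s = fr (g i) s \<oplus>\<^bsub>R\<^esub> fr (\<Sum>i\<in>A. g i) s"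
    using s by (simp add: add_R fr_eq_iff const_mult algebra_simps)
  with insert show ?case by (simp add: add)
qed (simp_all add: zero)

lemma test_ideal_subset: "\<tau> \<subseteq> ext (filt 3)"
proof
  fix x assume x: "x \<in> \<tau>"
  then have "x \<in> carrier R" by (simp add: test_ideal_def)
  then obtain a s where a: "x = fr a s" "const s \<noteq> 0" by (rule carrierE)
  have "3 \<le> deg m" if m: "m \<in> keys a" for m
  proof -
    from x[unfolded a(1)] a(2) m obtain i where
      i: "2 \<le> lookup m i" "3 \<le> lookup m i \<or> (\<exists>j. j \<noteq> i \<and> 1 \<le> lookup m j)"
      by (rule test_ideal_keys)
    from i(2) show ?thesis
    proof (elim disjE exE conjE)
      assume "3 \<le> lookup m i"
      then show ?thesis using lookup_le_deg[of m i] by simp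
    next
      fix j assume j: "j \<noteq> i" "1 \<le> lookup m j"
      have "(\<Sum>l\<in>{i, j}. lookup m l) \<le> deg m"
        unfolding deg_def by (rule sum_mono2) simp_all
      then show ?thesis using i(1) j by simp
    qed
  qed
  then have "a \<in> filt 3" by (rule filtI)
  then show "x \<in> ext (filt 3)" using a by (simp add: fr_mem_ext_iff[OF saturated_filt])
qed

lemma ext_filt_3_square_mem:
  assumes "r \<in> ext (filt 3)"
  shows "r [^]\<^bsub>R\<^esub> (2::nat) \<in> ideal_power R \<tau> 2"
proof -
  from assms obtain a s where a: "r = fr a s" "a \<in> filt 3" "const s \<noteq> 0" unfolding ext_def by blast
  have \<tau>2: "ideal_power R \<tau> 2 = ideal_prod R \<tau> (ideal_prod R \<tau> (carrier R))"
    by (simp add: numeral_2_eq_2)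
  \<comment> \<open>The recursion of \<open>ideal_power\<close> ends in \<open>carrier R\<close>;
    the third factor z will absorb the remaining monomial, the coefficient and the
    denominator.\<close>
  have memI: "fr (single (single i 1 + single j 2) 1) 1 \<otimes>\<^bsub>R\<^esub> (fr (single (single k 1 + single l 2) 1) 1 \<otimes>\<^bsub>R\<^esub> z)
      \<in> ideal_power R \<tau> 2" if "z \<in> carrier R" for i j k l z
    using that unfolding \<tau>2
    by (intro ideal_prod.prod monomial_test_ideal)
  have a2: "a\<^sup>2 = (\<Sum>m\<in>keys a. single (stretch 2 m) ((lookup a m)\<^sup>2))"
    using char2_power_sum[OF char2, where e = 1, of "\<lambda>m. single m (lookup a m)" "keys a"]
    by (simp flip: poly_mapping_sum_singles add: power_single)
  have "fr (a\<^sup>2) (s\<^sup>2) \<in> ideal_power R \<tau> 2"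
    unfolding a2
  proof (rule fr_sum_closed)
    show s2: "const (s\<^sup>2) \<noteq> 0" using a(3) by (simp add: const_power)
    show "x \<oplus>\<^bsub>R\<^esub> y \<in> ideal_power R \<tau> 2" if "x \<in> ideal_power R \<tau> 2" "y \<in> ideal_power R \<tau> 2" for x y
      using that unfolding \<tau>2 by (rule ideal_prod.sum)
    show "fr 0 (s\<^sup>2) \<in> ideal_power R \<tau> 2"
      using memI[of "fr 0 (s\<^sup>2)" 1 1 1 1] s2 by (simp add: mult_R const_mult)
    fix m assume m: "m \<in> keys a"
    have "Suc (Suc (Suc 0)) \<le> deg m" using filtD[OF a(2) _ m] by simp
    then obtain i m1 where 1: "m = single i 1 + m1" "Suc (Suc 0) \<le> deg m1" by (rule deg_SucE)
    from 1(2) obtain j m2 where 2: "m1 = single j 1 + m2" "Suc 0 \<le> deg m2" by (rule deg_SucE)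
    from 2(2) obtain k m3 where 3: "m2 = single k 1 + m3" by (rule deg_SucE)
    \<comment> \<open>This is (x_i x_j x_k)^2 = (x_i x_j^2)(x_i x_k^2), a product of two members of
      the test ideal even for distinct indices.\<close>
    have m_eq: "stretch 2 m = (single i 1 + single j 2) + ((single i 1 + single k 2) + stretch 2 m3)"
      unfolding 1(1) 2(1) 3 by (rule poly_mapping_eqI) (simp add: lookup_add lookup_single when_def)
    have "fr (single (stretch 2 m) ((lookup a m)\<^sup>2)) (s\<^sup>2) = fr (single (single i 1 + single j 2) 1) 1 \<otimes>\<^bsub>R\<^esub>
        (fr (single (single i 1 + single k 2) 1) 1 \<otimes>\<^bsub>R\<^esub> fr (single (stretch 2 m3) ((lookup a m)\<^sup>2)) (s\<^sup>2))"
      using s2 unfolding m_eq by (simp add: mult_R const_mult mult_single)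
    also have "\<dots> \<in> ideal_power R \<tau> 2"
      using s2 by (intro memI) simp
    finally show "fr (single (stretch 2 m) ((lookup a m)\<^sup>2)) (s\<^sup>2) \<in> ideal_power R \<tau> 2" .
  qed
  then show ?thesis using a by (simp add: power_R)
qed

lemma ext_filt_3_subset_integral_closure: "ext (filt 3) \<subseteq> integral_closure R \<tau>"
proof
  fix r assume r: "r \<in> ext (filt 3)"
  then have rc: "r \<in> carrier R" using ext_subset_carrier by blast
  have neg: "\<ominus>\<^bsub>R\<^esub> x = x" if "x \<in> carrier R" for x
    using that by (elim carrierE) (simp add: minus_R char2_uminus[OF char2])
  \<comment> \<open>The equation of integral dependence is r^2 + 0 r + r^2 = 0, valid in
    characteristic two.\<close>
  define a where "a = (\<lambda>i::nat. if i = 2 then r [^]\<^bsub>R\<^esub> (2::nat) else \<zero>\<^bsub>R\<^esub>)"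
  have "fr (single (single 1 1 + single 1 2) 1) 1 \<otimes>\<^bsub>R\<^esub> \<zero>\<^bsub>R\<^esub> \<in> ideal_power R \<tau> 1"
    unfolding One_nat_def ideal_power.simps
    by (rule ideal_prod.prod) (simp_all add: monomial_test_ideal[unfolded One_nat_def])
  then have a1: "a 1 \<in> ideal_power R \<tau> 1" by (simp add: a_def)
  have a2: "a 2 \<in> ideal_power R \<tau> 2" using ext_filt_3_square_mem[OF r] by (simp add: a_def)
  have "a i \<in> ideal_power R \<tau> i" if "i \<in> {1..2}" for i
  proof -
    have "i = 1 \<or> i = 2" using that by auto
    then show ?thesis by (rule disjE) (simp_all only: a1 a2)
  qed
  moreover have "r [^]\<^bsub>R\<^esub> (2::nat) \<oplus>\<^bsub>R\<^esub> (\<Oplus>\<^bsub>R\<^esub>i\<in>{1..2}. a i \<otimes>\<^bsub>R\<^esub> r [^]\<^bsub>R\<^esub> (2 - i)) = \<zero>\<^bsub>R\<^esub>"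
  proof -
    have "{1..2::nat} = {1, 2}" by auto
    then have "(\<Oplus>\<^bsub>R\<^esub>i\<in>{1..2}. a i \<otimes>\<^bsub>R\<^esub> r [^]\<^bsub>R\<^esub> (2 - i)) = r [^]\<^bsub>R\<^esub> (2::nat)"
      using rc by (simp add: a_def R.finsum_insert)
    also have "\<dots> = \<ominus>\<^bsub>R\<^esub> (r [^]\<^bsub>R\<^esub> (2::nat))" using rc by (simp add: neg)
    finally show ?thesis using rc by (simp add: R.r_neg)
  qed
  ultimately show "r \<in> integral_closure R \<tau>"
    unfolding integral_closure_def using rc
    by (intro CollectI conjI exI[of _ "2::nat"] exI[of _ a]) auto
qed

section \<open>Initial forms and integral dependence\<close>

lemma wcomp_power_low:
  fixes b :: "'k poly5"
  assumes "\<And>m. m \<in> keys b \<Longrightarrow> d \<le> deg m"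
  shows "wcomp deg (d * n) (b ^ n) = wcomp deg d b ^ n \<and> (\<forall>m\<in>keys (b ^ n). d * n \<le> deg m)"
proof (induction n)
  case 0
  have "wcomp deg 0 (single 0 (1::'k)) = single 0 1" unfolding wcomp_single by (simp add: deg_def)
  then show ?case by simp
next
  case (Suc n)
  have "wcomp deg (d + d * n) (b * b ^ n) = wcomp deg d b * wcomp deg (d * n) (b ^ n)"
    by (rule wcomp_mult_low) (use assms Suc deg_add in auto)
  moreover have "d + d * n \<le> deg m" if "m \<in> keys (b * b ^ n)" for m
  proof -
    from that obtain m1 m2 where "m1 \<in> keys b" "m2 \<in> keys (b ^ n)" "m = m1 + m2" by (rule keys_multE)
    then show ?thesis using assms[of m1] Suc by (simp add: deg_add add_mono)
  qed
  ultimately show ?case using Suc by simp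
qed

lemma f_dvd_powerD: "f dvd a ^ n \<Longrightarrow> f dvd a"
  using f_not_dvd_unit[of 1] f_dvd_mult by (induction n) auto

text \<open>The initial form of a polynomial of order at most 4 is not divisible by \<open>f\<close>, and \<open>f\<close> is prime,
  so the order of its powers is as large as expected.\<close>

lemma power_mem_filtD:
  assumes "b ^ n \<in> filt (d * n + 1)" and d: "d < 5"
    and b: "wcomp deg d b \<noteq> 0" "\<And>m. m \<in> keys b \<Longrightarrow> d \<le> deg m"
  shows False
proof -
  from assms(1) obtain h where h: "\<And>m. m \<in> keys (b ^ n + f * h) \<Longrightarrow> d * n + 1 \<le> deg m"
    unfolding filt_def by blast
  have "0 = wcomp deg (d * n) (b ^ n + f * h)"
    using h by (intro wcomp_eq_0[symmetric]) fastforce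
  also have "\<dots> = wcomp deg d b ^ n + wcomp deg (d * n) (f * h)"
    using wcomp_power_low[OF b(2)] by (simp add: wcomp_add)
  finally have "wcomp deg d b ^ n = - wcomp deg (d * n) (f * h)"
    by (metis add_eq_0_iff2)
  \<comment> \<open>As f is homogeneous, each homogeneous component of a multiple of f is again a
    multiple of f.\<close>
  moreover have "f dvd wcomp deg (d * n) (f * h)"
    by (subst wcomp_mult_homogeneous[OF deg_add keys_f_deg]) simp_all
  ultimately have "f dvd wcomp deg d b ^ n" by simp
  then have "f dvd wcomp deg d b" by (rule f_dvd_powerD)
  then obtain m where "m \<in> keys (wcomp deg d b)" "lookup m 1 \<ge> 5"
    using b(1) by (rule fermat_quintic_multiple_degree)
  then show False using d lookup_le_deg[of m 1] by (simp add: keys_wcomp)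
qed

lemma ideal_finsum_mem:
  assumes "ideal I R" "finite A" "\<And>i. i \<in> A \<Longrightarrow> g i \<in> I"
  shows "(\<Oplus>\<^bsub>R\<^esub>i\<in>A. g i) \<in> I"
  using assms(2,3)
proof (induction A rule: finite_induct)
  case empty
  then show ?case using assms(1) by (simp add: additive_subgroup.zero_closed ideal.axioms(1))
next
  case (insert i A)
  then have "(\<Oplus>\<^bsub>R\<^esub>i\<in>insert i A. g i) = g i \<oplus>\<^bsub>R\<^esub> (\<Oplus>\<^bsub>R\<^esub>i\<in>A. g i)"
    using ideal.Icarr[OF assms(1)] by (intro R.finsum_insert) auto
  with insert show ?case
    using additive_subgroup.a_closed[OF ideal.axioms(1)[OF assms(1)]] by simp
qed

text \<open>If r had order d \<le> 2, each term \<open>a i\<close> r^(n-i) with i \<ge> 1 would have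
  order at least 3i + d(n-i) > dn. The equation would then raise the order of r^n above dn, which
  \<open>power_mem_filtD\<close> excludes.\<close>

lemma integral_closure_subset_ext_filt_3: "integral_closure R \<tau> \<subseteq> ext (filt 3)"
proof
  fix r assume "r \<in> integral_closure R \<tau>"
  then obtain n a where r: "r \<in> carrier R" and n: "n \<ge> 1"
    and a: "\<And>i. i \<in> {1..n} \<Longrightarrow> a i \<in> ideal_power R \<tau> i"
    and eq: "r [^]\<^bsub>R\<^esub> n \<oplus>\<^bsub>R\<^esub> (\<Oplus>\<^bsub>R\<^esub>i\<in>{1..n}. a i \<otimes>\<^bsub>R\<^esub> r [^]\<^bsub>R\<^esub> (n - i)) = \<zero>\<^bsub>R\<^esub>"
    unfolding integral_closure_def by blast
  from r obtain b s where b: "r = fr b s" "const s \<noteq> 0" by (rule carrierE)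
  show "r \<in> ext (filt 3)"
  proof (rule ccontr)
    assume "r \<notin> ext (filt 3)"
    then have notin: "b \<notin> filt 3" using b by (simp add: fr_mem_ext_iff[OF saturated_filt])
    then have "b \<noteq> 0" using saturated_0[OF saturated_filt] by blast
    then obtain d where d: "wcomp deg d b \<noteq> 0" "\<And>m. m \<in> keys b \<Longrightarrow> d \<le> deg m"
      using obtain_bottom by blast
    have "d < 3"
    proof (rule ccontr)
      assume "\<not> d < 3"
      then have "b \<in> filt 3" using d(2) by (intro filtI) fastforce
      with notin show False ..
    qed
    have rd: "r \<in> ext (filt d)"
      using b d(2) by (simp add: fr_mem_ext_iff[OF saturated_filt] filtI)
    let ?I = "ext (filt (d * n + 1))"
    have I: "ideal ?I R" by (rule ideal_ext[OF saturated_filt])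
    have "a i \<otimes>\<^bsub>R\<^esub> r [^]\<^bsub>R\<^esub> (n - i) \<in> ?I" if i: "i \<in> {1..n}" for i
    proof -
      have "a i \<in> ext (filt (3 * i))"
        using a[OF i] ideal_power_subset_ext_filt[OF test_ideal_subset] by blast
      then have "a i \<otimes>\<^bsub>R\<^esub> r [^]\<^bsub>R\<^esub> (n - i) \<in> ext (filt (3 * i + d * (n - i)))"
        using ext_filt_power[OF rd] by (rule ext_filt_mult)
      moreover have "d * n + 1 \<le> 3 * i + d * (n - i)"
      proof -
        have "d * n = d * i + d * (n - i)" using i by (simp flip: distrib_left)
        moreover have "d * i \<le> 2 * i" by (rule mult_le_mono1) (use \<open>d < 3\<close> in simp)
        moreover have "1 \<le> i" using i by simp
        ultimately show ?thesis by linarith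
      qed
      ultimately show ?thesis using ext_mono[OF filt_antimono] by blast
    qed
    then have S: "(\<Oplus>\<^bsub>R\<^esub>i\<in>{1..n}. a i \<otimes>\<^bsub>R\<^esub> r [^]\<^bsub>R\<^esub> (n - i)) \<in> ?I"
      by (intro ideal_finsum_mem[OF I]) simp_all
    have "r [^]\<^bsub>R\<^esub> n = \<ominus>\<^bsub>R\<^esub> (\<Oplus>\<^bsub>R\<^esub>i\<in>{1..n}. a i \<otimes>\<^bsub>R\<^esub> r [^]\<^bsub>R\<^esub> (n - i))"
      by (rule R.minus_equality[symmetric, OF eq ideal.Icarr[OF I S] R.nat_pow_closed[OF r]])
    also have "\<dots> \<in> ?I" using S by (rule additive_subgroup.a_inv_closed[OF ideal.axioms(1)[OF I]])
    finally have "b ^ n \<in> filt (d * n + 1)"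
      using b by (simp add: power_R fr_mem_ext_iff[OF saturated_filt] const_power)
    then show False using power_mem_filtD[OF _ _ d] \<open>d < 3\<close> by simp
  qed
qed

lemma integral_closure_test_ideal: "integral_closure R \<tau> = ext (filt 3)"
  using integral_closure_subset_ext_filt_3 ext_filt_3_subset_integral_closure by blast

lemma maximal_ideal_cubed:
  "ideal_power R (genideal R {local_var 1, local_var 2, local_var 3, local_var 4, local_var 5}) 3 = ext (filt 3)"
    (is "ideal_power R (genideal R ?X) 3 = _")
proof
  let ?m = "genideal R ?X"
  have X: "?X \<subseteq> carrier R" by (simp add: local_var_eq)
  have "poly_var i \<in> filt 1" for i
    by (rule filtI) (simp add: poly_var_def)
  then have "local_var i \<in> ext (filt 1)" for i
    by (simp add: local_var_eq fr_mem_ext_iff[OF saturated_filt])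
  then have "?m \<subseteq> ext (filt 1)"
    by (intro R.genideal_minimal ideal_ext saturated_filt) simp
  from ideal_power_subset_ext_filt[OF this, of 3] show "ideal_power R ?m 3 \<subseteq> ext (filt 3)" by simp
  have "?X = Set.range local_var" unfolding UNIV_5 by (simp only: image_insert image_empty)
  then have "local_var i \<in> ?X" for i by (simp only: rangeI)
  then have var: "local_var i \<in> ?m" for i
    by (rule subsetD[OF R.genideal_self[OF X]])
  have memI: "local_var i \<otimes>\<^bsub>R\<^esub> (local_var j \<otimes>\<^bsub>R\<^esub> (local_var k \<otimes>\<^bsub>R\<^esub> z)) \<in> ideal_power R ?m 3"
    if "z \<in> carrier R" for i j k z
    using that unfolding numeral_3_eq_3 ideal_power.simps by (intro ideal_prod.prod var)
  show "ext (filt 3) \<subseteq> ideal_power R ?m 3"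
  proof
    fix r assume "r \<in> ext (filt 3)"
    then obtain a s where a: "r = fr a s" "a \<in> filt 3" "const s \<noteq> 0" unfolding ext_def by blast
    have "fr (\<Sum>m\<in>keys a. single m (lookup a m)) s \<in> ideal_power R ?m 3"
    proof (rule fr_sum_closed[OF a(3)])
      show "x \<oplus>\<^bsub>R\<^esub> y \<in> ideal_power R ?m 3" if "x \<in> ideal_power R ?m 3" "y \<in> ideal_power R ?m 3" for x y
        using that unfolding numeral_3_eq_3 ideal_power.simps by (rule ideal_prod.sum)
      show "fr 0 s \<in> ideal_power R ?m 3"
        using memI[of "fr 0 s" 1 1 1] a(3) by (simp add: mult_R local_var_eq const_mult)
      fix m assume m: "m \<in> keys a"
      have "Suc (Suc (Suc 0)) \<le> deg m" using filtD[OF a(2) _ m] by simp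
      then obtain i m1 where 1: "m = single i 1 + m1" "Suc (Suc 0) \<le> deg m1" by (rule deg_SucE)
      from 1(2) obtain j m2 where 2: "m1 = single j 1 + m2" "Suc 0 \<le> deg m2" by (rule deg_SucE)
      from 2(2) obtain k m3 where 3: "m2 = single k 1 + m3" by (rule deg_SucE)
      have "fr (single m (lookup a m)) s
          = local_var i \<otimes>\<^bsub>R\<^esub> (local_var j \<otimes>\<^bsub>R\<^esub> (local_var k \<otimes>\<^bsub>R\<^esub> fr (single m3 (lookup a m)) s))"
        using a(3) unfolding 1(1) 2(1) 3 by (simp add: local_var_eq mult_R const_mult poly_var_def mult_single)
      also have "\<dots> \<in> ideal_power R ?m 3" using a(3) by (intro memI) simp
      finally show "fr (single m (lookup a m)) s \<in> ideal_power R ?m 3" .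
    qed
    then show "r \<in> ideal_power R ?m 3" unfolding a(1) by (simp flip: poly_mapping_sum_singles)
  qed
qed

lemma squarefree_cubic:
  "local_var 1 \<otimes>\<^bsub>R\<^esub> local_var 2 \<otimes>\<^bsub>R\<^esub> local_var 3 \<in> ext (filt 3) - \<tau>"
proof -
  let ?m = "single 1 1 + single 2 1 + single 3 1 :: 5 \<Rightarrow>\<^sub>0 nat"
  have eq: "local_var 1 \<otimes>\<^bsub>R\<^esub> local_var 2 \<otimes>\<^bsub>R\<^esub> local_var 3 = fr (single ?m 1) 1"
    by (simp add: local_var_eq mult_R poly_var_def mult_single)
  have "single ?m 1 \<in> filt 3" by (rule filtI) (simp add: deg_add)
  then have "fr (single ?m 1) 1 \<in> ext (filt 3)" by (simp add: fr_mem_ext_iff[OF saturated_filt])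
  moreover have "fr (single ?m 1) 1 \<notin> \<tau>"
  proof
    assume "fr (single ?m 1) 1 \<in> \<tau>"
    then obtain i where "2 \<le> lookup ?m i"
      by (rule test_ideal_keys) simp_all
    then show False by (auto simp: lookup_add lookup_single when_def split: if_splits)
  qed
  ultimately show ?thesis unfolding eq by blast
qed

end

theorem mainTheorem4:
  fixes R :: "'k::field fermat_elem ring"
    and x :: "5 \<Rightarrow> 'k fermat_elem"
    and \<mm> \<tau> :: "'k fermat_elem set"
  assumes "CHAR('k) = 2"
    and "R = fermat_local_ring"
    and "x = local_var"
    and "\<mm> = genideal R {x 1, x 2, x 3, x 4, x 5}"
    and "\<tau> = test_ideal R 2"
  shows "\<not> integrally_closed_ideal R \<tau> \<and>
         integral_closure R \<tau> = ideal_power R \<mm> 3 \<and>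
         ideal_power R \<mm> 3 \<noteq> \<tau> \<and>
         x 1 \<otimes>\<^bsub>R\<^esub> x 2 \<otimes>\<^bsub>R\<^esub> x 3 \<in> ideal_power R \<mm> 3 - \<tau>"
proof -
  interpret fermat_char2 "TYPE('k)" by unfold_locales (rule assms(1))
  have "ideal_power R \<mm> 3 = ext (filt 3)" "integral_closure R \<tau> = ext (filt 3)"
    "x 1 \<otimes>\<^bsub>R\<^esub> x 2 \<otimes>\<^bsub>R\<^esub> x 3 \<in> ext (filt 3) - \<tau>"
    using maximal_ideal_cubed integral_closure_test_ideal squarefree_cubic unfolding assms(2-5) by simp_all
  then show ?thesis unfolding integrally_closed_ideal_def by auto
qed

end
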